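(* Let $\mathfrak g$ be a Lie algebra and $\mathcal X\subset\mathfrak g^*$ a coadjoint orbit of maximal dimension with a $\mathfrak g$-invariant complex structure for which the standard symplectic form $\omega_0$ is Kähler, and let $\frac1{2\pi\hbar}[\omega_0]\in H^2(\mathcal X,\mathbb Z)$. Then the quantum restriction of a polynomial function $f$ on $\mathfrak g^*$ onto $\mathcal X$ is given by $$f\big|_{\widehat{\mathcal X}}=f\big(x-i\hbar\,\mathrm{ad}_-(x)\big)\,1 .$$ On the right-hand side the first order differential operators $x^j-i\hbar\,\mathrm{ad}_-(x^j)$, which are the arguments of $f$, are Weyl symmetrized, and the resulting operator is applied to the unity function $1$ over $\mathcal X$.
   Context: Let $\hbar>0$. $\omega_0$ is the symplectic form on $\mathcal X$ generated by the linear Lie–Poisson bracket on $\mathfrak g^*$. With $2n=\dim\mathcal X$, let $F_0$ be local Kähler potentials, $\omega_0=i\bar\partial\partial F_0$. Consider the Hermitian line bundle with fiber form $(u,v)_\hbar=u\bar v\,e^{-F_0/\hbar}$ and the Hilbert space $\mathcal L(\mathcal X)$ of its antiholomorphic sections with $\|u\|^2=\frac1{(2\pi\hbar)^n}\int_{\mathcal X}(u,u)_\hbar\,dm$, where $dm=\mathrm{const}\cdot\frac1{n!}|\omega_0\wedge\dots\wedge\omega_0|$ and the constant is such that the reproducing kernel $\mathcal K=\sum_j|u_j|^2$ ($\{u_j\}$ an orthonormal basis) equals $e^{F_0/\hbar}$. The Wick symbol of an operator $T$ in $\mathcal L(\mathcal X)$ is the function $\psi=\frac1{\mathcal K}T\mathcal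 K$ (more precisely $T\mathcal K^{\#}=\psi^{\#}\mathcal K^{\#}$, where $\mathcal K^{\#}(x|y)=\sum_ju_j(x)\overline{u_j(y)}$, $T$ acts on the first argument, and $\psi(x)=\psi^{\#}(x|x)$); one writes $T=\widehat\psi$. In local complex coordinates $\omega_0=i\omega_{0\,\nu\mu}d\bar z^\nu\wedge dz^\mu$, and $\mathrm{ad}_-(\psi)=i\omega_0^{-1\mu\nu}\partial_\mu\psi\,\bar\partial_\nu$ denotes the $\partial/\partial\bar z$-component of the Hamiltonian field $\mathrm{ad}(\psi)=\{\psi,\cdot\}$. Fix a basis $\eta^1,\dots,\eta^m$ of $\mathfrak g$, regarded as linear functions on $\mathfrak g^*$, and let $x^j=\eta^j|_{\mathcal X}$. The operators $$\widehat x^{\,j}=x^j+i\,\mathrm{ad}_-(x^j)(F_0)-i\hbar\,\mathrm{ad}_-(x^j)$$ act in $\mathcal L(\mathcal X)$. For a polynomial $f=f(\eta^1,\dots,\eta^m)$ on $\mathfrak g^*$ the quantum restriction $f|_{\widehat{\mathcal X}}$ is the function on $\mathcal X$ defined by $\widehat{f|_{\widehat{\mathcal X}}}=f(\widehat x^{\,1},\dots,\widehat x^{\,m})$, where the operators $\widehat x^{\,j}$ are Weyl symmetrized. *)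

theory Defs
  imports
    "HOL-Analysis.Analysis"
    "HOL-Homology.Simplices"
    "HOL-Combinatorics.Multiset_Permutations"
begin

section \<open>Smooth and holomorphic maps\<close>

primrec Ck_on :: "nat \<Rightarrow> 'a::real_normed_vector set \<Rightarrow> ('a \<Rightarrow> 'b::real_normed_vector) \<Rightarrow> bool" where
  "Ck_on 0 S f \<longleftrightarrow> continuous_on S f"
| "Ck_on (Suc k) S f \<longleftrightarrow>
     (\<forall>x\<in>S. f differentiable (at x)) \<and> (\<forall>v. Ck_on k S (\<lambda>x. frechet_derivative f (at x) v))"

definition smooth_on :: "'a::real_normed_vector set \<Rightarrow> ('a \<Rightarrow> 'b::real_normed_vector) \<Rightarrow> bool" where
  "smooth_on S f \<longleftrightarrow> open S \<and> (\<forall>k. Ck_on k S f)"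

definition holomorphic_map :: "(complex^'n) set \<Rightarrow> (complex^'n \<Rightarrow> complex^'n) \<Rightarrow> bool" where
  "holomorphic_map S f \<longleftrightarrow> open S \<and>
     (\<forall>z\<in>S. \<exists>D. (f has_derivative D) (at z) \<and> (\<forall>c v. D (c *s v) = c *s D v))"

definition antiholomorphic_fun :: "(complex^'n) set \<Rightarrow> (complex^'n \<Rightarrow> complex) \<Rightarrow> bool" where
  "antiholomorphic_fun S f \<longleftrightarrow> open S \<and>
     (\<forall>z\<in>S. \<exists>D. (f has_derivative D) (at z) \<and> (\<forall>c v. D (c *s v) = cnj c * D v))"

text \<open>The Wirtinger derivatives \<open>\<partial>/\<partial>z\<^sup>\<mu>\<close> and \<open>\<partial>/\<partial>\<bar>z\<^sup>\<nu>\<close>.\<close>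

definition dz :: "'n \<Rightarrow> (complex^'n \<Rightarrow> complex) \<Rightarrow> complex^'n \<Rightarrow> complex" where
  "dz \<mu> f z = (frechet_derivative f (at z) (axis \<mu> 1)
               - \<i> * frechet_derivative f (at z) (axis \<mu> \<i>)) / 2"

definition dzbar :: "'n \<Rightarrow> (complex^'n \<Rightarrow> complex) \<Rightarrow> complex^'n \<Rightarrow> complex" where
  "dzbar \<nu> f z = (frechet_derivative f (at z) (axis \<nu> 1)
                  + \<i> * frechet_derivative f (at z) (axis \<nu> \<i>)) / 2"


section \<open>Lie algebras and coadjoint orbits\<close>

text \<open>A finite-dimensional real Lie algebra is a bracket on a type of class
  \<open>euclidean_space\<close> (the inner product plays no role); its dual is \<open>'g \<Rightarrow>\<^sub>L real\<close>.\<close>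

type_synonym 'g dual = "'g \<Rightarrow>\<^sub>L real"

definition lie_bracket :: "('g::euclidean_space \<Rightarrow> 'g \<Rightarrow> 'g) \<Rightarrow> bool" where
  "lie_bracket br \<longleftrightarrow> bilinear br \<and> (\<forall>a. br a a = 0) \<and>
     (\<forall>a b c. br a (br b c) + br b (br c a) + br c (br a b) = 0)"

definition lie_basis :: "('m::finite \<Rightarrow> 'g::euclidean_space) \<Rightarrow> bool" where
  "lie_basis \<eta> \<longleftrightarrow> inj \<eta> \<and> independent (range \<eta>) \<and> span (range \<eta>) = UNIV"

text \<open>\<open>coad_exp br a\<close> is the coadjoint action \<open>\<xi> \<mapsto> \<xi> \<circ> exp(ad a)\<close> of the group element
  \<open>exp(-a)\<close>; such elements generate the connected group of the Lie algebra.\<close>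

definition coad_exp :: "('g::euclidean_space \<Rightarrow> 'g \<Rightarrow> 'g) \<Rightarrow> 'g \<Rightarrow> 'g dual \<Rightarrow> 'g dual" where
  "coad_exp br a \<xi> =
     Blinfun (\<lambda>b. blinfun_apply \<xi> (suminf (\<lambda>k. (1 / fact k) *\<^sub>R ((br a ^^ k) b))))"

inductive_set coadjoint_orbit :: "('g::euclidean_space \<Rightarrow> 'g \<Rightarrow> 'g) \<Rightarrow> 'g dual \<Rightarrow> 'g dual set"
  for br \<xi>\<^sub>0 where
  base: "\<xi>\<^sub>0 \<in> coadjoint_orbit br \<xi>\<^sub>0"
| step: "\<xi> \<in> coadjoint_orbit br \<xi>\<^sub>0 \<Longrightarrow> coad_exp br a \<xi> \<in> coadjoint_orbit br \<xi>\<^sub>0"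

text \<open>The Hamiltonian vector field \<open>{a, \<cdot>}\<close> of the linear function \<open>a\<close> for the Lie--Poisson
  bracket \<open>{a, b}(\<xi>) = \<xi>([a, b])\<close>.\<close>

definition ham_field :: "('g::euclidean_space \<Rightarrow> 'g \<Rightarrow> 'g) \<Rightarrow> 'g \<Rightarrow> 'g dual \<Rightarrow> 'g dual" where
  "ham_field br a \<xi> = Blinfun (\<lambda>b. blinfun_apply \<xi> (br a b))"

definition orbit_tangent :: "('g::euclidean_space \<Rightarrow> 'g \<Rightarrow> 'g) \<Rightarrow> 'g dual \<Rightarrow> 'g dual set" where
  "orbit_tangent br \<xi> = range (\<lambda>a. ham_field br a \<xi>)"

definition maximal_orbit :: "('g::euclidean_space \<Rightarrow> 'g \<Rightarrow> 'g) \<Rightarrow> 'g dual \<Rightarrow> bool" where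
  "maximal_orbit br \<xi>\<^sub>0 \<longleftrightarrow> (\<forall>\<xi>. dim (orbit_tangent br \<xi>) \<le> dim (orbit_tangent br \<xi>\<^sub>0))"

text \<open>The symplectic form on orbits, \<open>\<omega>\<^sub>0({a, \<cdot>}, {b, \<cdot>}) = {a, b}\<close>; it is closed by the Jacobi
  identity. This sign is the one forced by
  \<open>{\<psi>, \<rho>} = i \<omega>\<^sup>-\<^sup>1\<^sup>\<mu>\<^sup>\<nu> (\<partial>\<^sub>\<mu>\<psi> \<partial>\<bar>\<^sub>\<nu>\<rho> - \<partial>\<bar>\<^sub>\<nu>\<psi> \<partial>\<^sub>\<mu>\<rho>)\<close> with
  \<open>\<omega>\<^sub>0 = i \<omega>\<^sub>\<nu>\<^sub>\<mu> d\<bar>z\<^sup>\<nu> \<and> dz\<^sup>\<mu>\<close>.\<close>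

definition symp_form ::
  "('g::euclidean_space \<Rightarrow> 'g \<Rightarrow> 'g) \<Rightarrow> 'g dual \<Rightarrow> 'g dual \<Rightarrow> 'g dual \<Rightarrow> real" where
  "symp_form br \<xi> u v =
     (THE r. \<exists>a b. u = ham_field br a \<xi> \<and> v = ham_field br b \<xi> \<and> r = blinfun_apply \<xi> (br a b))"


section \<open>Invariant Kaehler structures on an orbit\<close>

text \<open>A holomorphic atlas, given by the inverses of its charts: injective parametrizations of
  pieces of the orbit by open subsets of complex coordinate space.\<close>

record ('x, 'n, 'i) atlas =
  idx :: "'i set"
  domain_of :: "'i \<Rightarrow> (complex^'n) set"
  param :: "'i \<Rightarrow> complex^'n \<Rightarrow> 'x"

definition coord_points :: "('g::euclidean_space dual, 'n::finite, 'i) atlas \<Rightarrow> ('i \<times> (complex^'n)) set" where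
  "coord_points A = (SIGMA i:idx A. domain_of A i)"

definition point :: "('g::euclidean_space dual, 'n::finite, 'i) atlas \<Rightarrow> 'i \<times> (complex^'n) \<Rightarrow> 'g dual" where
  "point A p = param A (fst p) (snd p)"

definition coords_at :: "('g::euclidean_space dual, 'n::finite, 'i) atlas \<Rightarrow> 'g dual \<Rightarrow> 'i \<times> (complex^'n)" where
  "coords_at A \<xi> = (SOME p. p \<in> coord_points A \<and> point A p = \<xi>)"

definition change_domain ::
  "('g::euclidean_space dual, 'n::finite, 'i) atlas \<Rightarrow> ('g dual \<Rightarrow> 'g dual) \<Rightarrow> 'i \<Rightarrow> 'i \<Rightarrow> (complex^'n) set" where
  "change_domain A h i k = {z \<in> domain_of A i. h (param A i z) \<in> param A k ` domain_of A k}"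

definition chart_expr ::
  "('g::euclidean_space dual, 'n::finite, 'i) atlas \<Rightarrow> ('g dual \<Rightarrow> 'g dual) \<Rightarrow> 'i \<Rightarrow> 'i \<Rightarrow> complex^'n \<Rightarrow> complex^'n" where
  "chart_expr A h i k z = inv_into (domain_of A k) (param A k) (h (param A i z))"

text \<open>An orbit carries its manifold structure as an immersed submanifold, which need not be the
  subspace structure. Since orbits are initial submanifolds, a smooth injective map into the dual
  space with values in the orbit and derivative onto the tangent space of the orbit is an open
  embedding for the manifold structure.\<close>

definition complex_structure ::
  "('g::euclidean_space \<Rightarrow> 'g \<Rightarrow> 'g) \<Rightarrow> 'g dual set \<Rightarrow> ('g dual, 'n::finite, 'i) atlas \<Rightarrow> bool" where
  "complex_structure br X A \<longleftrightarrow>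
     point A ` coord_points A = X \<and>
     (\<forall>i\<in>idx A. smooth_on (domain_of A i) (param A i) \<and> inj_on (param A i) (domain_of A i) \<and>
        (\<forall>z\<in>domain_of A i.
           bij_betw (frechet_derivative (param A i) (at z)) UNIV (orbit_tangent br (param A i z)))) \<and>
     (\<forall>i\<in>idx A. \<forall>k\<in>idx A. holomorphic_map (change_domain A id i k) (chart_expr A id i k))"

definition invariant_structure ::
  "('g::euclidean_space \<Rightarrow> 'g \<Rightarrow> 'g) \<Rightarrow> ('g dual, 'n::finite, 'i) atlas \<Rightarrow> bool" where
  "invariant_structure br A \<longleftrightarrow>
     (\<forall>a. \<forall>i\<in>idx A. \<forall>k\<in>idx A.
        holomorphic_map (change_domain A (coad_exp br a) i k) (chart_expr A (coad_exp br a) i k))"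

definition pull_form ::
  "('g::euclidean_space \<Rightarrow> 'g \<Rightarrow> 'g) \<Rightarrow> (complex^'n::finite \<Rightarrow> 'g dual) \<Rightarrow> complex^'n
     \<Rightarrow> complex^'n \<Rightarrow> complex^'n \<Rightarrow> real" where
  "pull_form br \<phi> z v w =
     symp_form br (\<phi> z) (frechet_derivative \<phi> (at z) v) (frechet_derivative \<phi> (at z) w)"

text \<open>Type (1,1) and positivity. In the convention \<open>\<omega>\<^sub>0 = i \<omega>\<^sub>\<nu>\<^sub>\<mu> d\<bar>z\<^sup>\<nu> \<and> dz\<^sup>\<mu>\<close> the matrix
  \<open>\<omega>\<^sub>\<nu>\<^sub>\<mu>\<close> is positive definite iff \<open>\<omega>\<^sub>0(Jv, v) > 0\<close> for nonzero real \<open>v\<close>.\<close>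

definition kaehler ::
  "('g::euclidean_space \<Rightarrow> 'g \<Rightarrow> 'g) \<Rightarrow> ('g dual, 'n::finite, 'i) atlas \<Rightarrow> bool" where
  "kaehler br A \<longleftrightarrow> (\<forall>i\<in>idx A. \<forall>z\<in>domain_of A i.
     (\<forall>v w. pull_form br (param A i) z (\<i> *s v) (\<i> *s w) = pull_form br (param A i) z v w) \<and>
     (\<forall>v. v \<noteq> 0 \<longrightarrow> pull_form br (param A i) z (\<i> *s v) v > 0))"

text \<open>The matrix \<open>\<omega>\<^sub>\<nu>\<^sub>\<mu> = -i \<omega>\<^sub>0(\<partial>/\<partial>\<bar>z\<^sup>\<nu>, \<partial>/\<partial>z\<^sup>\<mu>)\<close>, with \<open>\<omega>\<^sub>0\<close> extended
  complex bilinearly; row index \<open>\<nu>\<close>, column index \<open>\<mu>\<close>.\<close>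

definition omega ::
  "('g::euclidean_space \<Rightarrow> 'g \<Rightarrow> 'g) \<Rightarrow> (complex^'n::finite \<Rightarrow> 'g dual) \<Rightarrow> complex^'n \<Rightarrow> complex^'n^'n" where
  "omega br \<phi> z = (\<chi> \<nu> \<mu>. - \<i> / 4 *
     (of_real (pull_form br \<phi> z (axis \<nu> 1) (axis \<mu> 1))
      - \<i> * of_real (pull_form br \<phi> z (axis \<nu> 1) (axis \<mu> \<i>))
      + \<i> * of_real (pull_form br \<phi> z (axis \<nu> \<i>) (axis \<mu> 1))
      + of_real (pull_form br \<phi> z (axis \<nu> \<i>) (axis \<mu> \<i>))))"

text \<open>\<open>ad\<^sub>-(\<psi>)\<rho> = i \<omega>\<^sup>-\<^sup>1\<^sup>\<mu>\<^sup>\<nu> \<partial>\<^sub>\<mu>\<psi> \<partial>\<bar>\<^sub>\<nu>\<rho>\<close>, first for functions of the coordinates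
  of one chart, then for functions on the orbit. The chart chosen by \<open>coords_at\<close> is immaterial,
  since \<open>ad\<^sub>-(\<psi>)\<close> is an invariantly defined vector field.\<close>

definition ad_minus_chart ::
  "('g::euclidean_space \<Rightarrow> 'g \<Rightarrow> 'g) \<Rightarrow> (complex^'n::finite \<Rightarrow> 'g dual)
     \<Rightarrow> (complex^'n \<Rightarrow> complex) \<Rightarrow> (complex^'n \<Rightarrow> complex) \<Rightarrow> complex^'n \<Rightarrow> complex" where
  "ad_minus_chart br \<phi> \<psi> \<rho> z =
     \<i> * (\<Sum>\<mu>\<in>UNIV. \<Sum>\<nu>\<in>UNIV. matrix_inv (omega br \<phi> z) $ \<mu> $ \<nu> * dz \<mu> \<psi> z * dzbar \<nu> \<rho> z)"

definition ad_minus ::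
  "('g::euclidean_space \<Rightarrow> 'g \<Rightarrow> 'g) \<Rightarrow> ('g dual, 'n::finite, 'i) atlas
     \<Rightarrow> ('g dual \<Rightarrow> complex) \<Rightarrow> ('g dual \<Rightarrow> complex) \<Rightarrow> 'g dual \<Rightarrow> complex" where
  "ad_minus br A \<psi> \<rho> \<xi> =
     (let (i, z) = coords_at A \<xi>
      in ad_minus_chart br (param A i) (\<psi> \<circ> param A i) (\<rho> \<circ> param A i) z)"


section \<open>The quantization condition\<close>

definition barycentric :: "real \<times> real \<Rightarrow> nat \<Rightarrow> real" where
  "barycentric p k = (if k = 0 then 1 - fst p - snd p else if k = 1 then fst p
                      else if k = 2 then snd p else 0)"

definition smooth_2_simplex :: "'g::euclidean_space dual set \<Rightarrow> ((nat \<Rightarrow> real) \<Rightarrow> 'g dual) \<Rightarrow> bool" where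
  "smooth_2_simplex X f \<longleftrightarrow> f \<in> extensional (standard_simplex 2) \<and>
     (\<exists>N \<sigma>. smooth_on N \<sigma> \<and> \<sigma> ` N \<subseteq> X \<and>
        (\<forall>p. barycentric p \<in> standard_simplex 2 \<longrightarrow> p \<in> N \<and> f (barycentric p) = \<sigma> p))"

definition period ::
  "('g::euclidean_space \<Rightarrow> 'g \<Rightarrow> 'g) \<Rightarrow> ((nat \<Rightarrow> real) \<Rightarrow> 'g dual) \<Rightarrow> real" where
  "period br f =
     integral {(s, t). 0 < s \<and> 0 < t \<and> s + t < 1}
       (\<lambda>p. symp_form br (f (barycentric p))
              (frechet_derivative (f \<circ> barycentric) (at p) (1, 0))
              (frechet_derivative (f \<circ> barycentric) (at p) (0, 1)))"

text \<open>\<open>[\<omega>\<^sub>0] / (2\<pi> hbar)\<close> lies in the image of integral cohomology in de Rham cohomology: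
  its integrals over integral smooth singular 2-cycles are integers.\<close>

definition integral_class ::
  "('g::euclidean_space \<Rightarrow> 'g \<Rightarrow> 'g) \<Rightarrow> 'g dual set \<Rightarrow> real \<Rightarrow> bool" where
  "integral_class br X hbar \<longleftrightarrow>
     (\<forall>c :: 'g dual chain. (\<forall>f\<in>Poly_Mapping.keys c. smooth_2_simplex X f) \<and> chain_boundary 2 c = 0 \<longrightarrow>
        (\<Sum>f\<in>Poly_Mapping.keys c. of_int (Poly_Mapping.lookup c f) * period br f) / (2 * pi * hbar) \<in> \<int>)"


section \<open>The Hermitian line bundle and its antiholomorphic sections\<close>

text \<open>Local Kaehler potentials and sections are functions of a chart index and a point of that
  chart, that is, on \<open>coord_points A\<close>; the line bundle is trivialized over the charts, with
  transition functions \<open>g i k\<close> expressed in the coordinates of chart \<open>i\<close>.\<close>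

type_synonym ('i, 'n) bsection = "'i \<times> (complex^'n) \<Rightarrow> complex"

definition kaehler_potentials ::
  "('g::euclidean_space \<Rightarrow> 'g \<Rightarrow> 'g) \<Rightarrow> ('g dual, 'n::finite, 'i) atlas \<Rightarrow> ('i \<times> (complex^'n) \<Rightarrow> real) \<Rightarrow> bool" where
  "kaehler_potentials br A F \<longleftrightarrow> (\<forall>i\<in>idx A.
     smooth_on (domain_of A i) (\<lambda>z. F (i, z)) \<and>
     (\<forall>z\<in>domain_of A i. \<forall>\<nu> \<mu>.
        omega br (param A i) z $ \<nu> $ \<mu> = dzbar \<nu> (dz \<mu> (\<lambda>w. of_real (F (i, w)))) z))"

definition hermitian_line_bundle ::
  "('g::euclidean_space dual, 'n::finite, 'i) atlas \<Rightarrow> ('i \<times> (complex^'n) \<Rightarrow> real) \<Rightarrow> real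
     \<Rightarrow> ('i \<Rightarrow> 'i \<Rightarrow> complex^'n \<Rightarrow> complex) \<Rightarrow> bool" where
  "hermitian_line_bundle A F hbar g \<longleftrightarrow>
     (\<forall>i\<in>idx A. \<forall>k\<in>idx A. antiholomorphic_fun (change_domain A id i k) (g i k)) \<and>
     (\<forall>(i, z)\<in>coord_points A. \<forall>(k, w)\<in>coord_points A. param A i z = param A k w \<longrightarrow>
        (cmod (g i k z))\<^sup>2 * exp (- F (i, z) / hbar) = exp (- F (k, w) / hbar)) \<and>
     (\<forall>(i, z)\<in>coord_points A. \<forall>(k, w)\<in>coord_points A. \<forall>(l, y)\<in>coord_points A.
        param A i z = param A k w \<and> param A k w = param A l y \<longrightarrow> g i k z * g k l w = g i l z)"

definition antihol_section ::
  "('g::euclidean_space dual, 'n::finite, 'i) atlas \<Rightarrow> ('i \<Rightarrow> 'i \<Rightarrow> complex^'n \<Rightarrow> complex)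
     \<Rightarrow> ('i, 'n) bsection \<Rightarrow> bool" where
  "antihol_section A g u \<longleftrightarrow>
     (\<forall>i\<in>idx A. antiholomorphic_fun (domain_of A i) (\<lambda>z. u (i, z))) \<and>
     (\<forall>(i, z)\<in>coord_points A. \<forall>(k, w)\<in>coord_points A.
        param A i z = param A k w \<longrightarrow> u (i, z) = g i k z * u (k, w))"

definition fiber_form ::
  "('g::euclidean_space dual, 'n::finite, 'i) atlas \<Rightarrow> ('i \<times> (complex^'n) \<Rightarrow> real) \<Rightarrow> real
     \<Rightarrow> ('i, 'n) bsection \<Rightarrow> ('i, 'n) bsection \<Rightarrow> 'g dual \<Rightarrow> complex" where
  "fiber_form A F hbar u v \<xi> =
     (let p = coords_at A \<xi> in u p * cnj (v p) * of_real (exp (- F p / hbar)))"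

text \<open>The measure \<open>const \<cdot> |\<omega>\<^sub>0 \<and> \<dots> \<and> \<omega>\<^sub>0| / n!\<close>: in coordinates
  \<open>|\<omega>\<^sub>0 \<and> \<dots> \<and> \<omega>\<^sub>0| / n! = 2\<^sup>n |det \<omega>\<^sub>\<nu>\<^sub>\<mu>|\<close> times Lebesgue measure, as
  \<open>i d\<bar>z \<and> dz = -2 dx \<and> dy\<close>.\<close>

definition liouville_measure ::
  "('g::euclidean_space \<Rightarrow> 'g \<Rightarrow> 'g) \<Rightarrow> 'g dual set \<Rightarrow> ('g dual, 'n::finite, 'i) atlas \<Rightarrow> real
     \<Rightarrow> 'g dual measure \<Rightarrow> bool" where
  "liouville_measure br X A const M \<longleftrightarrow>
     space M = X \<and>
     sets M = {B. B \<subseteq> X \<and> (\<forall>i\<in>idx A. {z \<in> domain_of A i. param A i z \<in> B} \<in> sets borel)} \<and>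
     (\<forall>i\<in>idx A. \<forall>B\<in>sets borel. B \<subseteq> domain_of A i \<longrightarrow>
        emeasure M (param A i ` B) =
          (\<integral>\<^sup>+z\<in>B. ennreal (const * (2 ^ CARD('n) * cmod (det (omega br (param A i) z)))) \<partial>lborel))"

definition section_inner ::
  "('g::euclidean_space dual, 'n::finite, 'i) atlas \<Rightarrow> ('i \<times> (complex^'n) \<Rightarrow> real) \<Rightarrow> real \<Rightarrow> 'g dual measure
     \<Rightarrow> ('i, 'n) bsection \<Rightarrow> ('i, 'n) bsection \<Rightarrow> complex" where
  "section_inner A F hbar M u v =
     of_real (1 / (2 * pi * hbar) ^ CARD('n)) * (LINT \<xi>|M. fiber_form A F hbar u v \<xi>)"

definition section_space ::
  "('g::euclidean_space dual, 'n::finite, 'i) atlas \<Rightarrow> ('i \<times> (complex^'n) \<Rightarrow> real) \<Rightarrow> real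
     \<Rightarrow> ('i \<Rightarrow> 'i \<Rightarrow> complex^'n \<Rightarrow> complex) \<Rightarrow> 'g dual measure \<Rightarrow> ('i, 'n) bsection set" where
  "section_space A F hbar g M = {u. antihol_section A g u \<and> integrable M (fiber_form A F hbar u u)}"

definition orthonormal_section_basis ::
  "('g::euclidean_space dual, 'n::finite, 'i) atlas \<Rightarrow> ('i \<times> (complex^'n) \<Rightarrow> real) \<Rightarrow> real
     \<Rightarrow> ('i \<Rightarrow> 'i \<Rightarrow> complex^'n \<Rightarrow> complex) \<Rightarrow> 'g dual measure \<Rightarrow> ('i, 'n) bsection set \<Rightarrow> bool" where
  "orthonormal_section_basis A F hbar g M B \<longleftrightarrow>
     B \<subseteq> section_space A F hbar g M \<and>
     (\<forall>u\<in>B. \<forall>v\<in>B. section_inner A F hbar M u v = (if u = v then 1 else 0)) \<and>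
     (\<forall>v\<in>section_space A F hbar g M. \<forall>\<epsilon>>0. \<exists>S a. finite S \<and> S \<subseteq> B \<and>
        (let r = (\<lambda>p. v p - (\<Sum>u\<in>S. a u * u p)) in Re (section_inner A F hbar M r r) < \<epsilon>))"

text \<open>\<open>sesqui_kernel B\<close> is the kernel \<open>\<K>\<^sup>#(x|y)\<close>; the normalization of the measure says that its
  restriction to the diagonal is \<open>exp(F\<^sub>0/hbar)\<close>.\<close>

definition sesqui_kernel :: "('i, 'n::finite) bsection set \<Rightarrow> 'i \<times> (complex^'n) \<Rightarrow> 'i \<times> (complex^'n) \<Rightarrow> complex" where
  "sesqui_kernel B p q = (\<Sum>\<^sub>\<infinity>u\<in>B. u p * cnj (u q))"

definition kernel_normalized ::
  "('g::euclidean_space dual, 'n::finite, 'i) atlas \<Rightarrow> ('i \<times> (complex^'n) \<Rightarrow> real) \<Rightarrow> real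
     \<Rightarrow> ('i, 'n) bsection set \<Rightarrow> bool" where
  "kernel_normalized A F hbar B \<longleftrightarrow>
     (\<forall>p\<in>coord_points A. ((\<lambda>u. (cmod (u p))\<^sup>2) has_sum exp (F p / hbar)) B)"


section \<open>Wick symbols and quantum restriction\<close>

text \<open>The defining relation \<open>T \<K>\<^sup># = \<psi>\<^sup># \<K>\<^sup>#\<close> is imposed where \<open>\<K>\<^sup>#\<close> does not vanish (in
  particular near the diagonal), as \<open>\<psi>\<^sup>#\<close> may have poles on the zero set of \<open>\<K>\<^sup>#\<close>.\<close>

definition is_wick_symbol ::
  "'g::euclidean_space dual set \<Rightarrow> ('g dual, 'n::finite, 'i) atlas \<Rightarrow> ('i, 'n) bsection set
     \<Rightarrow> (('i, 'n) bsection \<Rightarrow> ('i, 'n) bsection) \<Rightarrow> ('g dual \<Rightarrow> complex) \<Rightarrow> bool" where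
  "is_wick_symbol X A B T \<psi> \<longleftrightarrow> (\<exists>\<Psi> :: 'g dual \<Rightarrow> 'g dual \<Rightarrow> complex.
     (\<forall>p\<in>coord_points A. \<forall>q\<in>coord_points A. sesqui_kernel B p q \<noteq> 0 \<longrightarrow>
        T (\<lambda>p'. sesqui_kernel B p' q) p = \<Psi> (point A p) (point A q) * sesqui_kernel B p q) \<and>
     (\<forall>\<xi>\<in>X. \<psi> \<xi> = \<Psi> \<xi> \<xi>))"

text \<open>A polynomial in \<open>\<eta>\<^sup>1, \<dots>, \<eta>\<^sup>m\<close> is given by its coefficients, monomials being multisets of
  indices. Averaging over the distinct orderings of a multiset of size \<open>k\<close> is the same as averaging
  over all \<open>k!\<close> permutations.\<close>

definition weyl_symmetrized ::
  "('m multiset \<Rightarrow>\<^sub>0 complex) \<Rightarrow> ('m \<Rightarrow> ('x \<Rightarrow> complex) \<Rightarrow> ('x \<Rightarrow> complex)) \<Rightarrow> ('x \<Rightarrow> complex) \<Rightarrow> 'x \<Rightarrow> complex" where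
  "weyl_symmetrized f T u x =
     (\<Sum>m\<in>Poly_Mapping.keys f. Poly_Mapping.lookup f m / of_nat (card (permutations_of_multiset m)) *
        (\<Sum>js\<in>permutations_of_multiset m. foldr T js u x))"

definition coord_fun :: "('m \<Rightarrow> 'g::euclidean_space) \<Rightarrow> 'm \<Rightarrow> 'g dual \<Rightarrow> complex" where
  "coord_fun \<eta> j \<xi> = of_real (blinfun_apply \<xi> (\<eta> j))"

text \<open>\<open>x\<^sup>j + i ad\<^sub>-(x\<^sup>j)(F\<^sub>0) - i hbar ad\<^sub>-(x\<^sup>j)\<close>, acting on sections.\<close>

definition xhat ::
  "('g::euclidean_space \<Rightarrow> 'g \<Rightarrow> 'g) \<Rightarrow> ('g dual, 'n::finite, 'i) atlas \<Rightarrow> ('i \<times> (complex^'n) \<Rightarrow> real) \<Rightarrow> real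
     \<Rightarrow> ('m \<Rightarrow> 'g) \<Rightarrow> 'm \<Rightarrow> ('i, 'n) bsection \<Rightarrow> ('i, 'n) bsection" where
  "xhat br A F hbar \<eta> j u = (\<lambda>(i, z).
     let x = coord_fun \<eta> j \<circ> param A i; ad = ad_minus_chart br (param A i) x
     in (x z + \<i> * ad (\<lambda>w. of_real (F (i, w))) z) * u (i, z)
        - \<i> * of_real hbar * ad (\<lambda>w. u (i, w)) z)"

definition is_quantum_restriction ::
  "('g::euclidean_space \<Rightarrow> 'g \<Rightarrow> 'g) \<Rightarrow> 'g dual set \<Rightarrow> ('g dual, 'n::finite, 'i) atlas
     \<Rightarrow> ('i \<times> (complex^'n) \<Rightarrow> real) \<Rightarrow> real \<Rightarrow> ('i, 'n) bsection set
     \<Rightarrow> ('m \<Rightarrow> 'g) \<Rightarrow> ('m multiset \<Rightarrow>\<^sub>0 complex) \<Rightarrow> ('g dual \<Rightarrow> complex) \<Rightarrow> bool" where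
  "is_quantum_restriction br X A F hbar B \<eta> f \<psi> \<longleftrightarrow>
     is_wick_symbol X A B (weyl_symmetrized f (xhat br A F hbar \<eta>)) \<psi>"

end

theory Submission
  imports Defs "HOL-Complex_Analysis.Cauchy_Integral_Formula"
begin

text \<open>Write a section as \<open>u = exp(F\<^sub>0/hbar) \<rho>\<close>. The derivative of the exponential cancels the term
  \<open>i ad\<^sub>-(x\<^sup>j)(F\<^sub>0)\<close>, so that \<open>xhat\<^sup>j\<close> acts on \<open>\<rho>\<close> as
  \<open>x\<^sup>j - i hbar ad\<^sub>-(x\<^sup>j)\<close> (\<open>xhat_conjugation\<close>). The symbol of \<open>f(xhat)\<close> at a point \<open>q\<close> is therefore
  the value at \<open>q\<close> of \<open>f(x - i hbar ad\<^sub>-(x)) \<rho>\<^sub>q\<close>, where \<open>\<rho>\<^sub>q = exp(-F\<^sub>0/hbar) \<K>\<^sup>#(\<cdot>|q)\<close>, and what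
  has to be shown is that \<open>\<rho>\<^sub>q\<close> may be replaced by \<open>1\<close>.

  This holds because the operators differentiate in antiholomorphic directions only. Put
  \<open>G(z, w) = exp(-F\<^sub>0(z)/hbar) \<K>\<^sup>#(z|w)\<close>. The kernel is holomorphic in \<open>w\<close>, so the second argument
  contributes nothing to an antiholomorphic derivative of \<open>z \<mapsto> G(z, z)\<close>: such a derivative may be
  taken in the first argument alone and be restricted to the diagonal afterwards. Repeated, this gives
  \<open>f(x - i hbar ad\<^sub>-(x)) \<rho>\<^sub>q = f(x - i hbar ad\<^sub>-(x)) (z \<mapsto> G(z, z))\<close> at \<open>q\<close>
  (\<open>foldr_dbar_op_diagonal\<close>), and \<open>G(z, z) = 1\<close> is the normalization of the kernel
  (\<open>reduced_kernel_at_diagonal\<close>).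

  The argument rests on three facts. First, the kernel is smooth, antiholomorphic in its first and
  holomorphic in its second argument; it is a locally uniform limit of finite sums by Dini's theorem,
  and complex analysis along complex lines does the rest (\<open>J_holomorphic_kernel\<close>,
  \<open>J_holomorphic_derivative\<close>). Second, the coefficients of \<open>ad\<^sub>-(x\<^sup>j)\<close> are smooth, because positivity
  makes \<open>\<omega>\<^sub>\<nu>\<^sub>\<mu>\<close> invertible (\<open>omega_invertible\<close>, \<open>smooth_on_matrix_inv\<close>). Third, neither side depends on
  the charts: \<open>ad\<^sub>-(\<psi>)\<rho>\<close> is \<open>i\<close> times the antilinear part of \<open>d\<rho>\<close> on the vector that the Hermitian form pairs
  to \<open>\<partial>\<psi>\<close> (\<open>ad_minus_chart_eq_delbar\<close>), and the transition functions of the bundle enter \<open>\<rho>\<^sub>q\<close>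
  through a holomorphic factor, a constant for the operators (\<open>chart_op_change\<close>). Hence
  \<open>(f(xhat) \<K>\<^sup>#) / \<K>\<^sup>#\<close> is a function of two points of the orbit, as the definition of a symbol demands
  (\<open>symbol_well_defined\<close>).\<close>

section \<open>Calculus of smooth functions\<close>

lemma frechet_derivative_eqI:
  "(f has_derivative D) (at x) \<Longrightarrow> frechet_derivative f (at x) = D"
  by (metis frechet_derivative_at)

lemma frechet_derivative_cong_open:
  assumes "open S" "x \<in> S" "\<And>y. y \<in> S \<Longrightarrow> f y = g y"
  shows "frechet_derivative f (at x) = frechet_derivative g (at x)"
proof -
  have "(f has_derivative D) (at x) \<longleftrightarrow> (g has_derivative D) (at x)" for D
    using assms by (metis has_derivative_transform_within_open)
  then show ?thesis
    unfolding frechet_derivative_def by simp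
qed

lemma Ck_on_cong:
  assumes "open S" "\<And>x. x \<in> S \<Longrightarrow> f x = g x"
  shows "Ck_on k S f \<longleftrightarrow> Ck_on k S g"
  using assms(2)
proof (induction k arbitrary: f g)
  case 0
  then show ?case by (simp cong: continuous_on_cong)
next
  case (Suc k)
  have "f differentiable (at x) \<longleftrightarrow> g differentiable (at x)" if "x \<in> S" for x
    using that Suc.prems assms(1)
    by (metis differentiable_def has_derivative_transform_within_open)
  moreover have "Ck_on k S (\<lambda>x. frechet_derivative f (at x) v)
      \<longleftrightarrow> Ck_on k S (\<lambda>x. frechet_derivative g (at x) v)" for v
    by (rule Suc.IH) (metis Suc.prems assms(1) frechet_derivative_cong_open)
  ultimately show ?case by simp
qed

lemma Ck_on_SucD: "Ck_on (Suc k) S f \<Longrightarrow> Ck_on k S f"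
proof (induction k arbitrary: f)
  case 0
  then show ?case
    by (auto intro!: differentiable_imp_continuous_on
        simp: differentiable_on_def differentiable_at_withinI)
next
  case (Suc k)
  then show ?case by (metis Ck_on.simps(2))
qed

lemma Ck_on_const: "Ck_on k S (\<lambda>_. c)"
  by (induction k arbitrary: c) auto

lemma Ck_on_bounded_linear:
  assumes "bounded_linear l" "open S" "Ck_on k S f"
  shows "Ck_on k S (\<lambda>x. l (f x))"
  using assms(3)
proof (induction k arbitrary: f)
  case 0
  then show ?case
    by (simp add: bounded_linear.continuous_on[OF assms(1)])
next
  case (Suc k)
  have *: "((\<lambda>x. l (f x)) has_derivative (\<lambda>v. l (frechet_derivative f (at x) v))) (at x)"
    if "x \<in> S" for x
    using Suc.prems that bounded_linear.has_derivative[OF assms(1)]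
    by (auto simp: frechet_derivative_works)
  have "Ck_on k S (\<lambda>x. frechet_derivative (\<lambda>x. l (f x)) (at x) v)" for v
    using Suc.IH[of "\<lambda>x. frechet_derivative f (at x) v"] Suc.prems
      Ck_on_cong[OF assms(2), of "\<lambda>x. frechet_derivative (\<lambda>x. l (f x)) (at x) v"
        "\<lambda>x. l (frechet_derivative f (at x) v)"]
    by (auto simp: frechet_derivative_eqI[OF *])
  then show ?case
    using * by (auto simp: differentiable_def)
qed

lemma Ck_on_add:
  assumes "open S" "Ck_on k S f" "Ck_on k S g"
  shows "Ck_on k S (\<lambda>x. f x + g x)"
  using assms(2,3)
proof (induction k arbitrary: f g)
  case 0
  then show ?case by (simp add: continuous_on_add)
next
  case (Suc k)
  have *: "((\<lambda>x. f x + g x) has_derivative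
      (\<lambda>v. frechet_derivative f (at x) v + frechet_derivative g (at x) v)) (at x)"
    if "x \<in> S" for x
    using Suc.prems that by (auto simp: frechet_derivative_works intro!: has_derivative_add)
  have "Ck_on k S (\<lambda>x. frechet_derivative (\<lambda>x. f x + g x) (at x) v)" for v
    using Suc.IH[of "\<lambda>x. frechet_derivative f (at x) v" "\<lambda>x. frechet_derivative g (at x) v"]
      Suc.prems Ck_on_cong[OF assms(1), of "\<lambda>x. frechet_derivative (\<lambda>x. f x + g x) (at x) v"
        "\<lambda>x. frechet_derivative f (at x) v + frechet_derivative g (at x) v"]
    by (auto simp: frechet_derivative_eqI[OF *])
  then show ?case
    using * by (auto simp: differentiable_def)
qed

lemma Ck_on_mult:
  fixes f g :: "'a::real_normed_vector \<Rightarrow> 'b::real_normed_algebra"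
  assumes "open S" "Ck_on k S f" "Ck_on k S g"
  shows "Ck_on k S (\<lambda>x. f x * g x)"
  using assms(2,3)
proof (induction k arbitrary: f g)
  case 0
  then show ?case by (simp add: continuous_on_mult)
next
  case (Suc k)
  have *: "((\<lambda>x. f x * g x) has_derivative
      (\<lambda>v. f x * frechet_derivative g (at x) v + frechet_derivative f (at x) v * g x)) (at x)"
    if "x \<in> S" for x
    using Suc.prems that by (auto simp: frechet_derivative_works intro!: has_derivative_mult)
  have "Ck_on k S (\<lambda>x. frechet_derivative (\<lambda>x. f x * g x) (at x) v)" for v
  proof -
    have "Ck_on k S (\<lambda>x. f x * frechet_derivative g (at x) v + frechet_derivative f (at x) v * g x)"
      using Suc.prems Ck_on_SucD[OF Suc.prems(1)] Ck_on_SucD[OF Suc.prems(2)]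
      by (intro Ck_on_add Suc.IH assms) auto
    then show ?thesis
      using Ck_on_cong[OF assms(1), of "\<lambda>x. frechet_derivative (\<lambda>x. f x * g x) (at x) v"]
      by (auto simp: frechet_derivative_eqI[OF *])
  qed
  then show ?case
    using * by (auto simp: differentiable_def)
qed

lemma Ck_on_exp:
  fixes f :: "'a::real_normed_vector \<Rightarrow> complex"
  assumes "open S" "Ck_on k S f"
  shows "Ck_on k S (\<lambda>x. exp (f x))"
  using assms(2)
proof (induction k)
  case 0
  then show ?case by (simp add: continuous_on_exp)
next
  case (Suc k)
  have *: "((\<lambda>x. exp (f x)) has_derivative
      (\<lambda>v. frechet_derivative f (at x) v * exp (f x))) (at x)"
    if "x \<in> S" for x
    using Suc.prems that
    by (auto simp: frechet_derivative_works has_field_derivative_def mult.commute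
        intro!: has_derivative_compose[of f _ _ _ exp, THEN has_derivative_eq_rhs]
        DERIV_exp[unfolded has_field_derivative_def])
  have "Ck_on k S (\<lambda>x. frechet_derivative (\<lambda>x. exp (f x)) (at x) v)" for v
    using Ck_on_mult[OF assms(1), of k "\<lambda>x. frechet_derivative f (at x) v" "\<lambda>x. exp (f x)"]
      Suc Ck_on_SucD[OF Suc.prems]
      Ck_on_cong[OF assms(1), of "\<lambda>x. frechet_derivative (\<lambda>x. exp (f x)) (at x) v"]
    by (auto simp: frechet_derivative_eqI[OF *])
  then show ?case
    using * by (auto simp: differentiable_def)
qed

lemma Ck_on_inverse:
  fixes f :: "'a::real_normed_vector \<Rightarrow> 'b::real_normed_field"
  assumes "open S" "Ck_on k S f" "\<And>x. x \<in> S \<Longrightarrow> f x \<noteq> 0"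
  shows "Ck_on k S (\<lambda>x. inverse (f x))"
  using assms(2)
proof (induction k)
  case 0
  then show ?case by (simp add: continuous_on_inverse assms)
next
  case (Suc k)
  have *: "((\<lambda>x. inverse (f x)) has_derivative
      (\<lambda>v. - (inverse (f x) * frechet_derivative f (at x) v * inverse (f x)))) (at x)"
    if "x \<in> S" for x
    using Suc.prems that assms(3)
    by (auto simp: frechet_derivative_works intro!: has_derivative_inverse)
  have "Ck_on k S (\<lambda>x. frechet_derivative (\<lambda>x. inverse (f x)) (at x) v)" for v
  proof -
    have "Ck_on k S (\<lambda>x. - (inverse (f x) * frechet_derivative f (at x) v * inverse (f x)))"
      using Suc Ck_on_SucD[OF Suc.prems]
      by (intro Ck_on_bounded_linear[OF bounded_linear_minus[OF bounded_linear_ident]]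
          Ck_on_mult assms) auto
    then show ?thesis
      using Ck_on_cong[OF assms(1), of "\<lambda>x. frechet_derivative (\<lambda>x. inverse (f x)) (at x) v"]
      by (auto simp: frechet_derivative_eqI[OF *])
  qed
  then show ?case
    using * by (auto simp: differentiable_def)
qed

lemma smooth_on_open: "smooth_on S f \<Longrightarrow> open S"
  by (simp add: smooth_on_def)

lemma smooth_on_const: "open S \<Longrightarrow> smooth_on S (\<lambda>_. c)"
  by (simp add: smooth_on_def Ck_on_const)

lemma smooth_on_bounded_linear:
  "bounded_linear l \<Longrightarrow> smooth_on S f \<Longrightarrow> smooth_on S (\<lambda>x. l (f x))"
  by (simp add: smooth_on_def Ck_on_bounded_linear)

lemma smooth_on_add: "smooth_on S f \<Longrightarrow> smooth_on S g \<Longrightarrow> smooth_on S (\<lambda>x. f x + g x)"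
  by (simp add: smooth_on_def Ck_on_add)

lemma smooth_on_mult:
  fixes f g :: "'a::real_normed_vector \<Rightarrow> 'b::real_normed_algebra"
  shows "smooth_on S f \<Longrightarrow> smooth_on S g \<Longrightarrow> smooth_on S (\<lambda>x. f x * g x)"
  by (simp add: smooth_on_def Ck_on_mult)

lemma smooth_on_diff: "smooth_on S f \<Longrightarrow> smooth_on S g \<Longrightarrow> smooth_on S (\<lambda>x. f x - g x)"
  using smooth_on_add[of S f "\<lambda>x. - g x"]
    smooth_on_bounded_linear[OF bounded_linear_minus[OF bounded_linear_ident], of S g] by simp

lemma smooth_on_exp:
  fixes f :: "'a::real_normed_vector \<Rightarrow> complex"
  shows "smooth_on S f \<Longrightarrow> smooth_on S (\<lambda>x. exp (f x))"
  by (simp add: smooth_on_def Ck_on_exp)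

lemma smooth_on_inverse:
  fixes f :: "'a::real_normed_vector \<Rightarrow> 'b::real_normed_field"
  shows "smooth_on S f \<Longrightarrow> (\<And>x. x \<in> S \<Longrightarrow> f x \<noteq> 0) \<Longrightarrow> smooth_on S (\<lambda>x. inverse (f x))"
  by (simp add: smooth_on_def Ck_on_inverse)

lemma smooth_on_sum:
  assumes "open S" "\<And>i. i \<in> I \<Longrightarrow> smooth_on S (f i)"
  shows "smooth_on S (\<lambda>x. \<Sum>i\<in>I. f i x)"
  using assms(2)
  by (induction I rule: infinite_finite_induct) (auto intro: smooth_on_const smooth_on_add assms(1))

lemma smooth_on_prod:
  fixes f :: "'i \<Rightarrow> 'a::real_normed_vector \<Rightarrow> complex"
  assumes "open S" "\<And>i. i \<in> I \<Longrightarrow> smooth_on S (f i)"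
  shows "smooth_on S (\<lambda>x. \<Prod>i\<in>I. f i x)"
  using assms(2)
  by (induction I rule: infinite_finite_induct) (auto intro: smooth_on_const smooth_on_mult assms(1))

lemma smooth_on_cong:
  "(\<And>x. x \<in> S \<Longrightarrow> f x = g x) \<Longrightarrow> smooth_on S f \<longleftrightarrow> smooth_on S g"
  using Ck_on_cong[of S f g] by (auto simp: smooth_on_def)

lemma smooth_on_derivative: "smooth_on S f \<Longrightarrow> smooth_on S (\<lambda>x. frechet_derivative f (at x) v)"
  by (metis Ck_on.simps(2) smooth_on_def)

lemma smooth_on_differentiable: "smooth_on S f \<Longrightarrow> x \<in> S \<Longrightarrow> f differentiable (at x)"
  by (metis Ck_on.simps(2) smooth_on_def)

lemma smooth_on_has_derivative:
  "smooth_on S f \<Longrightarrow> x \<in> S \<Longrightarrow> (f has_derivative frechet_derivative f (at x)) (at x)"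
  by (meson frechet_derivative_works smooth_on_differentiable)

lemma smooth_on_dz: "smooth_on S f \<Longrightarrow> smooth_on S (dz \<mu> f)"
  unfolding dz_def[abs_def] divide_inverse
  by (intro smooth_on_mult smooth_on_diff smooth_on_derivative smooth_on_const) (auto simp: smooth_on_def)

lemma smooth_on_dzbar: "smooth_on S f \<Longrightarrow> smooth_on S (dzbar \<mu> f)"
  unfolding dzbar_def[abs_def] divide_inverse
  by (intro smooth_on_mult smooth_on_add smooth_on_derivative smooth_on_const) (auto simp: smooth_on_def)

section \<open>Holomorphy with respect to a complex structure\<close>

text \<open>One notion serves for antiholomorphic functions, where \<open>J\<close> is multiplication by \<open>-i\<close>, and for
  functions of a pair that are antiholomorphic in the first and holomorphic in the second variable,
  where \<open>J(a, b) = (-i a, i b)\<close>.\<close>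

definition J_holomorphic ::
  "('a::real_normed_vector \<Rightarrow> 'a) \<Rightarrow> 'a set \<Rightarrow> ('a \<Rightarrow> complex) \<Rightarrow> bool" where
  "J_holomorphic J S f \<longleftrightarrow> open S \<and>
     (\<forall>z\<in>S. \<exists>D. (f has_derivative D) (at z) \<and> (\<forall>v. D (J v) = \<i> * D v))"

lemma J_holomorphic_open: "J_holomorphic J S f \<Longrightarrow> open S"
  by (simp add: J_holomorphic_def)

lemma J_holomorphicD:
  assumes "J_holomorphic J S f" "z \<in> S"
  shows "(f has_derivative frechet_derivative f (at z)) (at z)"
    and "frechet_derivative f (at z) (J v) = \<i> * frechet_derivative f (at z) v"
  using assms by (auto simp: J_holomorphic_def dest!: bspec dest: frechet_derivative_eqI)

lemma J_holomorphic_subset: "J_holomorphic J S f \<Longrightarrow> open T \<Longrightarrow> T \<subseteq> S \<Longrightarrow> J_holomorphic J T f"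
  by (auto simp: J_holomorphic_def)

lemma J_holomorphic_continuous_on:
  assumes "J_holomorphic J S f" shows "continuous_on S f"
  using J_holomorphicD(1)[OF assms]
  by (meson continuous_at_imp_continuous_on has_derivative_continuous)

lemma J_holomorphic_diff:
  assumes "J_holomorphic J S f" "J_holomorphic J S g"
  shows "J_holomorphic J S (\<lambda>z. f z - g z)"
  unfolding J_holomorphic_def
proof (intro conjI ballI)
  show "open S" using assms(1) by (rule J_holomorphic_open)
  fix z assume "z \<in> S"
  note * = J_holomorphicD[OF assms(1) this] J_holomorphicD[OF assms(2) this]
  show "\<exists>D. ((\<lambda>z. f z - g z) has_derivative D) (at z) \<and> (\<forall>v. D (J v) = \<i> * D v)"
    by (rule exI, rule conjI, rule has_derivative_diff[OF *(1) *(3)]) (simp add: * algebra_simps)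
qed

lemma J_holomorphic_sum:
  assumes "open S" "\<And>i. i \<in> I \<Longrightarrow> J_holomorphic J S (f i)"
  shows "J_holomorphic J S (\<lambda>z. \<Sum>i\<in>I. f i z)"
  unfolding J_holomorphic_def
proof (intro conjI ballI)
  fix z assume "z \<in> S"
  note * = J_holomorphicD[OF assms(2) this]
  show "\<exists>D. ((\<lambda>z. \<Sum>i\<in>I. f i z) has_derivative D) (at z) \<and> (\<forall>v. D (J v) = \<i> * D v)"
    by (intro exI[of _ "\<lambda>v. \<Sum>i\<in>I. frechet_derivative (f i) (at z) v"] conjI has_derivative_sum *(1))
      (simp_all add: * sum_distrib_left)
qed fact

lemma J_holomorphic_mult:
  assumes "J_holomorphic J S f" "J_holomorphic J S g"
  shows "J_holomorphic J S (\<lambda>z. f z * g z)"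
  unfolding J_holomorphic_def
proof (intro conjI ballI)
  show "open S" using assms(1) by (rule J_holomorphic_open)
  fix z assume "z \<in> S"
  note * = J_holomorphicD[OF assms(1) this] J_holomorphicD[OF assms(2) this]
  show "\<exists>D. ((\<lambda>z. f z * g z) has_derivative D) (at z) \<and> (\<forall>v. D (J v) = \<i> * D v)"
    by (rule exI, rule conjI, rule has_derivative_mult[OF *(1) *(3)]) (simp add: * algebra_simps)
qed

lemma slice_in_ball:
  fixes J :: "'a::real_normed_vector \<Rightarrow> 'a"
  assumes "norm (J v) \<le> norm v" "2 * cmod s * norm v < r"
  shows "z + (Re s *\<^sub>R v + Im s *\<^sub>R J v) \<in> ball z r"
proof -
  have "norm (Re s *\<^sub>R v + Im s *\<^sub>R J v) \<le> \<bar>Re s\<bar> * norm v + \<bar>Im s\<bar> * norm (J v)"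
    by (metis norm_scaleR norm_triangle_ineq)
  also have "\<dots> \<le> cmod s * norm v + cmod s * norm v"
    by (intro add_mono mult_mono abs_Re_le_cmod abs_Im_le_cmod assms) auto
  also have "\<dots> < r"
    using assms(2) by (simp add: mult_ac)
  finally have "norm (Re s *\<^sub>R v + Im s *\<^sub>R J v) < r" .
  then show ?thesis
    by (metis add_diff_cancel_left' dist_norm dist_commute mem_ball)
qed

text \<open>Along the line \<open>s \<mapsto> z + Re s \<cdot> v + Im s \<cdot> J v\<close> a \<open>J\<close>-holomorphic function is holomorphic in the
  usual sense. This is how one-variable theory enters.\<close>

lemma J_holomorphic_slice:
  fixes J :: "'a::real_normed_vector \<Rightarrow> 'a"
  assumes "J_holomorphic J S f" "z + (Re s *\<^sub>R v + Im s *\<^sub>R J v) \<in> S"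
  shows "((\<lambda>s. f (z + (Re s *\<^sub>R v + Im s *\<^sub>R J v))) has_field_derivative
    frechet_derivative f (at (z + (Re s *\<^sub>R v + Im s *\<^sub>R J v))) v) (at s)"
proof -
  let ?p = "z + (Re s *\<^sub>R v + Im s *\<^sub>R J v)"
  let ?D = "frechet_derivative f (at ?p)"
  have D: "(f has_derivative ?D) (at ?p)" and J: "?D (J v) = \<i> * ?D v"
    using J_holomorphicD[OF assms] by auto
  have "((\<lambda>s. z + (Re s *\<^sub>R v + Im s *\<^sub>R J v)) has_derivative (\<lambda>t. Re t *\<^sub>R v + Im t *\<^sub>R J v)) (at s)"
    by (auto intro!: derivative_eq_intros)
  from has_derivative_compose[OF this D]
  have "((\<lambda>s. f (z + (Re s *\<^sub>R v + Im s *\<^sub>R J v))) has_derivative (\<lambda>t. ?D (Re t *\<^sub>R v + Im t *\<^sub>R J v))) (at s)" .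
  moreover have "?D (Re t *\<^sub>R v + Im t *\<^sub>R J v) = ?D v * t" for t
  proof -
    have lin: "linear ?D" using D by (rule has_derivative_linear)
    have "?D (Re t *\<^sub>R v + Im t *\<^sub>R J v) = of_real (Re t) * ?D v + of_real (Im t) * (\<i> * ?D v)"
      by (simp add: linear_add[OF lin] linear_scale[OF lin] J scaleR_conv_of_real)
    also have "\<dots> = ?D v * t"
      by (subst (3) complex_eq[of t]) (simp add: algebra_simps)
    finally show ?thesis .
  qed
  ultimately show ?thesis
    by (simp add: has_field_derivative_def)
qed

text \<open>Cauchy's inequality on a slice. In the constant one factor 2 comes from
  \<open>\<bar>Re s v + Im s J v\<bar> \<le> 2 \<bar>s\<bar> \<bar>v\<bar>\<close>, the other keeps a closed disc inside the open ball.\<close>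

lemma Cauchy_estimate:
  fixes J :: "'a::real_normed_vector \<Rightarrow> 'a"
  assumes f: "J_holomorphic J S f" and J: "norm (J v) \<le> norm v"
    and r: "0 < r" "ball z r \<subseteq> S" and M: "\<And>x. x \<in> ball z r \<Longrightarrow> cmod (f x) \<le> M"
  shows "cmod (frechet_derivative f (at z) v) \<le> 4 * M / r * norm v"
proof (cases "v = 0")
  case True
  have "z \<in> S" using r by auto
  then show ?thesis
    using linear_0[OF has_derivative_linear[OF J_holomorphicD(1)[OF f]]] True by simp
next
  case False
  define h where "h = (\<lambda>s. f (z + (Re s *\<^sub>R v + Im s *\<^sub>R J v)))"
  define \<rho> where "\<rho> = r / (4 * norm v)"
  have \<rho>: "0 < \<rho>" using r False by (simp add: \<rho>_def)
  have in_ball: "z + (Re s *\<^sub>R v + Im s *\<^sub>R J v) \<in> ball z r" if "cmod s \<le> \<rho>" for s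
  proof (rule slice_in_ball[where J = J, OF J])
    have "2 * cmod s * norm v \<le> 2 * \<rho> * norm v"
      using that by (intro mult_right_mono) auto
    also have "\<dots> < r" using r False by (simp add: \<rho>_def)
    finally show "2 * cmod s * norm v < r" .
  qed
  have der: "(h has_field_derivative
      frechet_derivative f (at (z + (Re s *\<^sub>R v + Im s *\<^sub>R J v))) v) (at s)"
    if "cmod s \<le> \<rho>" for s
    unfolding h_def using in_ball[OF that] r by (intro J_holomorphic_slice[OF f]) auto
  have "cmod ((deriv ^^ 1) h 0) \<le> fact 1 * M / \<rho> ^ 1"
  proof (rule Cauchy_inequality)
    show "h holomorphic_on ball 0 \<rho>"
      unfolding holomorphic_on_open[OF open_ball]
      by (intro ballI exI, rule der) simp
    show "continuous_on (cball 0 \<rho>) h"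
      by (intro continuous_at_imp_continuous_on ballI, rule DERIV_isCont, rule der) simp
    show "cmod (h x) \<le> M" if "cmod (0 - x) = \<rho>" for x
      unfolding h_def using that by (intro M in_ball) simp
  qed fact
  moreover have "deriv h 0 = frechet_derivative f (at z) v"
    using DERIV_imp_deriv[OF der[of 0]] \<rho> by simp
  ultimately show ?thesis by (simp add: \<rho>_def mult_ac)
qed

text \<open>The point is that the bound depends on \<open>f\<close> only through \<open>M\<close>; on the slices through varying base
  points it makes difference quotients converge uniformly. Cauchy's inequality on discs of radius
  \<open>r/4\<close> bounds the second derivative by \<open>2 M / (r/4)\<^sup>2\<close>.\<close>

lemma second_order_Taylor_bound:
  assumes f: "f holomorphic_on ball 0 r" and r: "0 < r" and M: "\<And>x. x \<in> ball 0 r \<Longrightarrow> cmod (f x) \<le> M"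
    and t: "cmod t < r / 2"
  shows "cmod (f t - f 0 - t * deriv f 0) \<le> 32 * M / r\<^sup>2 * (cmod t)\<^sup>2"
proof -
  have B: "cmod ((deriv ^^ 2) f x) \<le> 32 * M / r\<^sup>2" if "x \<in> ball 0 (r/2)" for x
  proof -
    have sub: "cball x (r/4) \<subseteq> ball 0 r"
      using that r by (simp add: cball_subset_ball_iff)
    have "cmod ((deriv ^^ 2) f x) \<le> fact 2 * M / (r/4) ^ 2"
    proof (rule Cauchy_inequality)
      show "f holomorphic_on ball x (r/4)"
        using f sub by (meson ball_subset_cball holomorphic_on_subset subset_trans)
      show "continuous_on (cball x (r/4)) f"
        using f sub by (meson holomorphic_on_imp_continuous_on holomorphic_on_subset)
      show "0 < r/4" using r by simp
      show "cmod (f y) \<le> M" if "cmod (x - y) = r / 4" for y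
        using M[of y] sub that by (auto simp: dist_norm subset_eq)
    qed
    then show ?thesis by (simp add: power_divide fact_numeral)
  qed
  have "cmod ((deriv ^^ 0) f t - (\<Sum>i\<le>1. (deriv ^^ i) f 0 * (t - 0) ^ i / fact i))
      \<le> 32 * M / r\<^sup>2 * cmod (t - 0) ^ Suc 1 / fact 1"
  proof (rule complex_Taylor[where S = "ball 0 (r/2)" and f = "\<lambda>i. (deriv ^^ i) f" and n = 1])
    fix i x assume "x \<in> ball (0::complex) (r/2)"
    then have x: "x \<in> ball 0 r" using r by auto
    have "(deriv ^^ i) f holomorphic_on ball 0 r"
      by (intro holomorphic_higher_deriv f) auto
    then show "((deriv ^^ i) f has_field_derivative (deriv ^^ Suc i) f x) (at x within ball 0 (r/2))"
      using x by (simp add: holomorphic_derivI[of _ "ball 0 r"])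
  qed (use B t r in \<open>auto simp: numeral_2_eq_2\<close>)
  then show ?thesis by (simp add: algebra_simps power2_eq_square)
qed

text \<open>Weierstrass' theorem. By Cauchy's estimate the derivatives of a uniformly convergent sequence are
  uniformly Cauchy on the ball of half the radius, so the limit may be differentiated termwise.\<close>

lemma J_holomorphic_uniform_limit:
  fixes f :: "nat \<Rightarrow> 'a::real_normed_vector \<Rightarrow> complex"
  assumes hol: "\<And>n. J_holomorphic J (ball z\<^sub>0 r) (f n)" and J: "\<And>v. norm (J v) \<le> norm v"
    and r: "0 < r" and lim: "uniform_limit (ball z\<^sub>0 r) f g sequentially"
  shows "\<exists>D. (g has_derivative D) (at z\<^sub>0) \<and> (\<forall>v. D (J v) = \<i> * D v)"
proof -
  define S where "S = ball z\<^sub>0 (r/2)"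
  define D where "D n z = frechet_derivative (f n) (at z)" for n z
  have sub: "ball z (r/2) \<subseteq> ball z\<^sub>0 r" if "z \<in> S" for z
  proof
    fix x assume "x \<in> ball z (r/2)"
    then show "x \<in> ball z\<^sub>0 r"
      using that dist_triangle[of z\<^sub>0 x z] by (simp add: S_def)
  qed
  have S: "S \<subseteq> ball z\<^sub>0 r" using r by (auto simp: S_def)
  note D = J_holomorphicD[OF hol, folded D_def]
  have cauchy: "\<exists>N. \<forall>m\<ge>N. \<forall>n\<ge>N. \<forall>z\<in>S. \<forall>v. cmod (D m z v - D n z v) \<le> e * norm v" if "0 < e" for e
  proof -
    have "0 < e * r / 16" using that r by simp
    then obtain N where N: "dist (f n z) (g z) < e * r / 16" if "n \<ge> N" "z \<in> ball z\<^sub>0 r" for n z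
      using uniform_limitD[OF lim] unfolding eventually_sequentially by metis
    have "cmod (D m z v - D n z v) \<le> e * norm v" if "m \<ge> N" "n \<ge> N" "z \<in> S" for m n z v
    proof -
      have z: "z \<in> ball z\<^sub>0 r" using that S by auto
      have "cmod (f m x - f n x) \<le> e * r / 8" if "x \<in> ball z (r/2)" for x
      proof -
        have "x \<in> ball z\<^sub>0 r" using that sub[OF \<open>z \<in> S\<close>] by blast
        then have "dist (f m x) (g x) < e * r / 16" "dist (f n x) (g x) < e * r / 16"
          using N \<open>m \<ge> N\<close> \<open>n \<ge> N\<close> by auto
        then show ?thesis
          using dist_triangle2[of "f m x" "f n x" "g x"] by (simp add: dist_norm)
      qed
      from Cauchy_estimate[OF J_holomorphic_diff[OF hol hol] J _ sub[OF \<open>z \<in> S\<close>] this, of v] r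
      have "cmod (frechet_derivative (\<lambda>x. f m x - f n x) (at z) v) \<le> e * norm v"
        by (simp add: field_simps)
      moreover have "frechet_derivative (\<lambda>x. f m x - f n x) (at z) = (\<lambda>v. D m z v - D n z v)"
        by (intro frechet_derivative_eqI has_derivative_diff D z)
      ultimately show ?thesis by simp
    qed
    then show ?thesis by blast
  qed
  define g' where "g' z v = lim (\<lambda>n. D n z v)" for z v
  have g': "(\<lambda>n. D n z v) \<longlonglongrightarrow> g' z v" if "z \<in> S" for z v
  proof -
    have "Cauchy (\<lambda>n. D n z v)"
    proof (rule metric_CauchyI)
      fix e :: real assume "0 < e"
      then have e: "0 < e / (norm v + 1)" by (simp add: add_nonneg_pos)
      from cauchy[OF e] obtain N where N: "\<forall>m\<ge>N. \<forall>n\<ge>N. \<forall>z\<in>S. \<forall>u.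
          cmod (D m z u - D n z u) \<le> e / (norm v + 1) * norm u" by (rule exE)
      have less: "e / (norm v + 1) * norm v < e"
      proof -
        have "0 < norm v + 1" by (simp add: add_nonneg_pos)
        moreover have "e * norm v < e * (norm v + 1)" using \<open>0 < e\<close> by simp
        ultimately show ?thesis by (simp add: pos_divide_less_eq)
      qed
      show "\<exists>N. \<forall>m\<ge>N. \<forall>n\<ge>N. dist (D m z v) (D n z v) < e"
        unfolding dist_norm using N that by (intro exI[of _ N] allI impI le_less_trans[OF _ less]) simp
    qed
    then show ?thesis
      unfolding g'_def using Cauchy_convergent convergent_LIMSEQ_iff by blast
  qed
  have "\<exists>h. \<forall>x\<in>S. (\<lambda>n. f n x) \<longlonglongrightarrow> h x \<and> (h has_derivative g' x) (at x within S)"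
  proof (rule has_derivative_sequence)
    show "convex S" by (simp add: S_def)
    show "(f n has_derivative D n x) (at x within S)" if "x \<in> S" for n x
      using D(1) that S by (meson has_derivative_at_withinI subsetD)
    show "z\<^sub>0 \<in> S" using r by (simp add: S_def)
    show "(\<lambda>n. f n z\<^sub>0) \<longlonglongrightarrow> g z\<^sub>0"
      using tendsto_uniform_limitI[OF lim] r by simp
    show "\<forall>\<^sub>F n in sequentially. \<forall>x\<in>S. \<forall>h. cmod (D n x h - g' x h) \<le> e * norm h"
      if "0 < e" for e
    proof -
      from cauchy[OF that] obtain N where N: "\<forall>m\<ge>N. \<forall>n\<ge>N. \<forall>z\<in>S. \<forall>v.
          cmod (D m z v - D n z v) \<le> e * norm v" by (rule exE)
      have "cmod (D n x h - g' x h) \<le> e * norm h" if "n \<ge> N" "x \<in> S" for n x h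
      proof (rule Lim_norm_ubound[OF sequentially_bot])
        show "(\<lambda>m. D n x h - D m x h) \<longlonglongrightarrow> D n x h - g' x h"
          by (intro tendsto_intros g' that)
        show "\<forall>\<^sub>F m in sequentially. cmod (D n x h - D m x h) \<le> e * norm h"
          unfolding eventually_sequentially using N that by (intro exI[of _ N]) simp
      qed
      then show ?thesis by (auto simp: eventually_sequentially)
    qed
  qed
  then obtain h where h: "\<And>x. x \<in> S \<Longrightarrow> (\<lambda>n. f n x) \<longlonglongrightarrow> h x"
    and h': "\<And>x. x \<in> S \<Longrightarrow> (h has_derivative g' x) (at x within S)" by blast
  have z0: "z\<^sub>0 \<in> S" using r by (simp add: S_def)
  have "h x = g x" if "x \<in> S" for x
    using LIMSEQ_unique[OF h[OF that] tendsto_uniform_limitI[OF lim]] that S by auto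
  then have "(g has_derivative g' z\<^sub>0) (at z\<^sub>0)"
    using h'[OF z0] z0 at_within_open[of z\<^sub>0 S]
    by (metis S_def has_derivative_transform_within_open open_ball)
  moreover have "g' z\<^sub>0 (J v) = \<i> * g' z\<^sub>0 v" for v
  proof (rule LIMSEQ_unique[OF g'[OF z0]])
    show "(\<lambda>n. D n z\<^sub>0 (J v)) \<longlonglongrightarrow> \<i> * g' z\<^sub>0 v"
      using D(2) z0 S by (auto intro!: tendsto_intros g' simp: subset_eq)
  qed
  ultimately show ?thesis by blast
qed

lemma J_holomorphic_const: "open S \<Longrightarrow> J_holomorphic J S (\<lambda>_. c)"
  unfolding J_holomorphic_def by (auto intro!: exI[of _ "\<lambda>_. 0"])

lemma J_holomorphic_translate:
  assumes "J_holomorphic J S f" "open T" "\<And>z. z \<in> T \<Longrightarrow> z + c \<in> S"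
  shows "J_holomorphic J T (\<lambda>z. f (z + c))"
  unfolding J_holomorphic_def
proof (intro conjI ballI)
  fix z assume "z \<in> T"
  note D = J_holomorphicD[OF assms(1) assms(3)[OF this]]
  have "((\<lambda>z. z + c) has_derivative (\<lambda>v. v)) (at z)"
    by (auto intro!: derivative_eq_intros)
  from has_derivative_compose[OF this D(1)] D(2)
  show "\<exists>D. ((\<lambda>z. f (z + c)) has_derivative D) (at z) \<and> (\<forall>v. D (J v) = \<i> * D v)" by blast
qed fact

text \<open>A directional derivative is the locally uniform limit of difference quotients, and these are
  \<open>J\<close>-holomorphic; so Weierstrass' theorem applies.\<close>

lemma J_holomorphic_derivative:
  assumes f: "J_holomorphic J S f" and J: "\<And>v. norm (J v) \<le> norm v"
  shows "J_holomorphic J S (\<lambda>z. frechet_derivative f (at z) v)"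
  unfolding J_holomorphic_def
proof (intro conjI ballI)
  show "open S" using f by (rule J_holomorphic_open)
  fix z\<^sub>0 assume z0: "z\<^sub>0 \<in> S"
  define M where "M = cmod (f z\<^sub>0) + 1"
  have "isCont f z\<^sub>0"
    using J_holomorphicD(1)[OF f z0] by (rule has_derivative_continuous)
  then obtain r1 where r1: "0 < r1" "\<And>x. dist x z\<^sub>0 < r1 \<Longrightarrow> dist (f x) (f z\<^sub>0) < 1"
    unfolding continuous_at_eps_delta using zero_less_one by blast
  obtain r2 where r2: "0 < r2" "ball z\<^sub>0 r2 \<subseteq> S"
    using \<open>open S\<close> z0 by (meson open_contains_ball)
  define r where "r = min r1 r2 / 2"
  have r: "0 < r" using r1 r2 by (simp add: r_def)
  have big: "ball z\<^sub>0 (2 * r) \<subseteq> S"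
    using r2 by (auto simp: r_def)
  have M: "cmod (f x) \<le> M" if "x \<in> ball z\<^sub>0 (2 * r)" for x
  proof -
    have "dist (f x) (f z\<^sub>0) < 1" using that by (intro r1) (auto simp: r_def dist_commute)
    then show ?thesis
      using norm_triangle_sub[of "f x" "f z\<^sub>0"] by (simp add: M_def dist_norm)
  qed
  have near: "ball z r \<subseteq> ball z\<^sub>0 (2 * r)" if "z \<in> ball z\<^sub>0 r" for z
  proof
    fix x assume "x \<in> ball z r"
    then show "x \<in> ball z\<^sub>0 (2 * r)"
      using that dist_triangle[of z\<^sub>0 x z] by simp
  qed
  \<comment> \<open>For \<open>\<bar>s\<bar> < \<rho>\<close> the slice through a point of the ball of radius \<open>r\<close> stays in the ball of radius \<open>2 r\<close>; the \<open>1\<close> covers \<open>v = 0\<close>.\<close>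
  define \<rho> where "\<rho> = r / (2 * (norm v + 1))"
  have \<rho>: "0 < \<rho>" using r by (simp add: \<rho>_def add_nonneg_pos)
  have small: "2 * cmod s * norm v < r" if "cmod s < \<rho>" for s
  proof -
    have "2 * cmod s * norm v \<le> cmod s * (2 * (norm v + 1))" by (simp add: algebra_simps)
    also have "\<dots> < r" using that by (simp add: \<rho>_def pos_less_divide_eq add_nonneg_pos)
    finally show ?thesis .
  qed
  define t :: "nat \<Rightarrow> real" where "t n = \<rho> / 4 / real (Suc n)" for n
  have t: "0 < t n" "t n < \<rho> / 2" for n
  proof -
    show "0 < t n" using \<rho> by (simp add: t_def)
    have "t n \<le> \<rho> / 4" unfolding t_def using \<rho> by (simp add: divide_le_eq)
    then show "t n < \<rho> / 2" using \<rho> by linarith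
  qed
  define q where "q n z = of_real (1 / t n) * (f (z + t n *\<^sub>R v) - f z)" for n z
  have shift: "z + (Re s *\<^sub>R v + Im s *\<^sub>R J v) \<in> ball z\<^sub>0 (2 * r)"
    if "z \<in> ball z\<^sub>0 r" "cmod s < \<rho>" for z s
    using slice_in_ball[where J = J, OF J small] that near by blast
  have estimate: "cmod (q n z - frechet_derivative f (at z) v) \<le> 32 * M / \<rho>\<^sup>2 * t n"
    if z: "z \<in> ball z\<^sub>0 r" for n z
  proof -
    define h where "h = (\<lambda>s. f (z + (Re s *\<^sub>R v + Im s *\<^sub>R J v)))"
    have der: "(h has_field_derivative
        frechet_derivative f (at (z + (Re s *\<^sub>R v + Im s *\<^sub>R J v))) v) (at s)"
      if "cmod s < \<rho>" for s
      unfolding h_def using shift[OF z that] big by (intro J_holomorphic_slice[OF f]) auto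
    have tn: "cmod (of_real (t n)) = t n" using t(1)[of n] by simp
    have "cmod (h (of_real (t n)) - h 0 - of_real (t n) * deriv h 0)
        \<le> 32 * M / \<rho>\<^sup>2 * (cmod (of_real (t n)))\<^sup>2"
    proof (rule second_order_Taylor_bound[OF _ \<rho>])
      show "h holomorphic_on ball 0 \<rho>"
        unfolding holomorphic_on_open[OF open_ball]
        by (intro ballI exI, rule der) simp
      show "cmod (h x) \<le> M" if "x \<in> ball 0 \<rho>" for x
        unfolding h_def using that by (intro M shift z) simp
    qed (use t tn in simp)
    moreover have "deriv h 0 = frechet_derivative f (at z) v"
      using DERIV_imp_deriv[OF der[of 0]] \<rho> by simp
    moreover have "h (of_real (t n)) - h 0 - of_real (t n) * deriv h 0
        = of_real (t n) * (q n z - deriv h 0)"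
      using t(1)[of n] by (simp add: q_def h_def field_simps)
    ultimately have "t n * cmod (q n z - frechet_derivative f (at z) v) \<le> 32 * M / \<rho>\<^sup>2 * (t n)\<^sup>2"
      using t(1)[of n] by (simp add: norm_mult)
    then have "t n * cmod (q n z - frechet_derivative f (at z) v) \<le> t n * (32 * M / \<rho>\<^sup>2 * t n)"
      by (simp add: power2_eq_square mult_ac)
    then show ?thesis using t(1)[of n] by (simp only: mult_le_cancel_left_pos)
  qed
  have hol: "J_holomorphic J (ball z\<^sub>0 r) (q n)" for n
    unfolding q_def
  proof (intro J_holomorphic_mult J_holomorphic_const J_holomorphic_diff J_holomorphic_translate[OF f])
    show "J_holomorphic J (ball z\<^sub>0 r) f"
      using f big r by (rule_tac J_holomorphic_subset[OF f]) (auto simp: subset_eq)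
    show "z + t n *\<^sub>R v \<in> S" if "z \<in> ball z\<^sub>0 r" for z
      using shift[OF that, of "of_real (t n)"] t[of n] \<rho> big by auto
  qed auto
  have "(\<lambda>n. 32 * M / \<rho>\<^sup>2 * (\<rho> / 4 * (1 / real (Suc n)))) \<longlonglongrightarrow> 32 * M / \<rho>\<^sup>2 * (\<rho> / 4 * 0)"
    by (intro tendsto_intros LIMSEQ_Suc[OF lim_1_over_n])
  then have t0: "(\<lambda>n. 32 * M / \<rho>\<^sup>2 * t n) \<longlonglongrightarrow> 0"
    by (simp add: t_def)
  have "uniform_limit (ball z\<^sub>0 r) q (\<lambda>z. frechet_derivative f (at z) v) sequentially"
  proof (rule uniform_limitI)
    fix e :: real assume "0 < e"
    from order_tendstoD(2)[OF t0 this]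
    show "\<forall>\<^sub>F n in sequentially. \<forall>z\<in>ball z\<^sub>0 r. dist (q n z) (frechet_derivative f (at z) v) < e"
      by eventually_elim (auto simp: dist_norm intro: le_less_trans[OF estimate])
  qed
  from J_holomorphic_uniform_limit[OF hol J r this]
  show "\<exists>D. ((\<lambda>z. frechet_derivative f (at z) v) has_derivative D) (at z\<^sub>0) \<and> (\<forall>v. D (J v) = \<i> * D v)" .
qed

lemma J_holomorphic_imp_smooth:
  assumes "J_holomorphic J S f" and "\<And>v. norm (J v) \<le> norm v"
  shows "smooth_on S f"
proof -
  have "Ck_on k S f" for k
    using assms(1)
  proof (induction k arbitrary: f)
    case 0
    then show ?case by (simp add: J_holomorphic_continuous_on)
  next
    case (Suc k)
    then show ?case
      using J_holomorphicD(1)[OF Suc.prems] J_holomorphic_derivative[OF Suc.prems assms(2)]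
      by (auto simp: differentiable_def)
  qed
  then show ?thesis
    using assms(1) by (simp add: smooth_on_def J_holomorphic_open)
qed

section \<open>The symplectic form in complex coordinates\<close>

lemma linear_bracket:
  assumes "lie_bracket br"
  shows "linear (br a)" "linear (\<lambda>a. br a b)"
  using assms by (auto simp: lie_bracket_def bilinear_def)

lemma bracket_antisym:
  assumes "lie_bracket br" shows "br a b = - br b a"
proof -
  have "br (a + b) (a + b) = 0" "br a a = 0" "br b b = 0"
    using assms by (auto simp: lie_bracket_def)
  moreover have "br (a + b) (a + b) = br a a + br a b + (br b a + br b b)"
    by (simp add: linear_add[OF linear_bracket(1)[OF assms]] linear_add[OF linear_bracket(2)[OF assms]]
        algebra_simps)
  ultimately show ?thesis by (simp add: eq_neg_iff_add_eq_0)
qed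

lemma ham_field_apply:
  assumes "lie_bracket br"
  shows "blinfun_apply (ham_field br a \<xi>) b = blinfun_apply \<xi> (br a b)"
proof -
  have "bounded_linear (\<lambda>b. blinfun_apply \<xi> (br a b))"
    by (intro bounded_linear_compose[OF blinfun.bounded_linear_right]
        linear_conv_bounded_linear[THEN iffD1] linear_bracket assms)
  then show ?thesis
    by (simp add: ham_field_def bounded_linear_Blinfun_apply)
qed

text \<open>The value depends on \<open>a\<close> and \<open>b\<close> only through their Hamiltonian vectors at \<open>\<xi>\<close>: for \<open>b\<close> this is seen
  from \<open>\<xi>([a, b]) = {a, \<cdot>}(b)\<close> after exchanging the two by antisymmetry.\<close>

lemma symp_form_ham_field:
  assumes "lie_bracket br"
  shows "symp_form br \<xi> (ham_field br a \<xi>) (ham_field br b \<xi>) = blinfun_apply \<xi> (br a b)"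
  unfolding symp_form_def
proof (rule the_equality)
  fix r
  assume "\<exists>a' b'. ham_field br a \<xi> = ham_field br a' \<xi> \<and> ham_field br b \<xi> = ham_field br b' \<xi>
    \<and> r = blinfun_apply \<xi> (br a' b')"
  then obtain a' b' where *: "ham_field br a \<xi> = ham_field br a' \<xi>"
    "ham_field br b \<xi> = ham_field br b' \<xi>" "r = blinfun_apply \<xi> (br a' b')" by blast
  have "r = blinfun_apply \<xi> (br a b')"
    using * by (metis ham_field_apply[OF assms])
  also have "\<dots> = - blinfun_apply \<xi> (br b' a)"
    by (subst bracket_antisym[OF assms]) (simp add: blinfun.minus_right)
  also have "\<dots> = - blinfun_apply \<xi> (br b a)"
    using * by (metis ham_field_apply[OF assms])
  also have "\<dots> = blinfun_apply \<xi> (br a b)"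
    by (subst bracket_antisym[OF assms]) (simp add: blinfun.minus_right)
  finally show "r = blinfun_apply \<xi> (br a b)" .
qed blast

text \<open>If the tangent vectors are \<open>{a, \<cdot>}\<close> and \<open>{b, \<cdot>}\<close>, the form is \<open>{a, \<cdot>}(b) = - {b, \<cdot>}(a)\<close>. For a fixed
  choice of \<open>b\<close> the first expression is linear in the vector \<open>{a, \<cdot>}\<close>, and symmetrically for the second.\<close>

lemma linear_pull_form:
  fixes \<phi> :: "complex^'n::finite \<Rightarrow> 'g::euclidean_space dual"
  assumes lie: "lie_bracket br" and lin: "linear (frechet_derivative \<phi> (at z))"
    and ran: "range (frechet_derivative \<phi> (at z)) = orbit_tangent br (\<phi> z)"
  shows "linear (\<lambda>v. pull_form br \<phi> z v w)" "linear (pull_form br \<phi> z v)"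
proof -
  let ?D = "frechet_derivative \<phi> (at z)"
  have "\<forall>v. \<exists>a. ?D v = ham_field br a (\<phi> z)"
    using ran by (auto simp: orbit_tangent_def)
  then obtain a where a: "\<And>v. ?D v = ham_field br (a v) (\<phi> z)" by metis
  have eq: "pull_form br \<phi> z v w = blinfun_apply (\<phi> z) (br (a v) (a w))" for v w
    by (simp add: pull_form_def a symp_form_ham_field[OF lie])
  have "pull_form br \<phi> z v w = blinfun_apply (?D v) (a w)" for v w
    by (simp add: eq a ham_field_apply[OF lie])
  then show "linear (\<lambda>v. pull_form br \<phi> z v w)"
    by (auto intro!: linearI simp: linear_add[OF lin] linear_scale[OF lin] blinfun.add_left blinfun.scaleR_left)
  have "pull_form br \<phi> z v w = - blinfun_apply (?D w) (a v)" for v w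
    unfolding eq a ham_field_apply[OF lie]
    by (subst bracket_antisym[OF lie]) (simp add: blinfun.minus_right)
  then show "linear (pull_form br \<phi> z v)"
    by (auto intro!: linearI simp: linear_add[OF lin] linear_scale[OF lin] blinfun.add_left blinfun.scaleR_left)
qed

text \<open>The sesquilinear form whose matrix is \<open>\<omega>\<^sub>\<nu>\<^sub>\<mu>\<close>, antilinear in the first argument. Being written in
  terms of the real form \<open>\<omega>\<^sub>0\<close> alone, it passes from chart to chart by the chain rule.\<close>

definition hermitian_form ::
  "('g::euclidean_space \<Rightarrow> 'g \<Rightarrow> 'g) \<Rightarrow> (complex^'n::finite \<Rightarrow> 'g dual) \<Rightarrow> complex^'n
     \<Rightarrow> complex^'n \<Rightarrow> complex^'n \<Rightarrow> complex" where
  "hermitian_form br \<phi> z v w =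
     - (of_real (pull_form br \<phi> z v (\<i> *s w)) + \<i> * of_real (pull_form br \<phi> z v w)) / 2"

lemma complex_smult_eq:
  fixes v :: "complex^'n"
  shows "c *s v = Re c *\<^sub>R v + Im c *\<^sub>R (\<i> *s v)"
  by (simp add: vec_eq_iff) (metis (no_types) complex_eq mult.commute mult.left_commute distrib_right scaleR_conv_of_real)

lemma axis_imaginary: "axis \<nu> \<i> = \<i> *s (axis \<nu> 1 :: complex^'n)"
  by (simp add: vec_eq_iff axis_def)

lemma complex_linear_expansion:
  fixes L :: "complex^'n::finite \<Rightarrow> complex"
  assumes "\<And>v w. L (v + w) = L v + L w" "\<And>c v. L (c *s v) = c * L v"
  shows "L v = (\<Sum>\<mu>\<in>UNIV. v $ \<mu> * L (axis \<mu> 1))"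
proof -
  have "L 0 = 0" using assms(2)[of 0 0] by simp
  then have "L (\<Sum>\<mu>\<in>I. v $ \<mu> *s axis \<mu> 1) = (\<Sum>\<mu>\<in>I. v $ \<mu> * L (axis \<mu> 1))" for I
    by (induction I rule: infinite_finite_induct) (simp_all add: assms)
  then show ?thesis by (metis basis_expansion)
qed

lemma complex_antilinear_expansion:
  fixes L :: "complex^'n::finite \<Rightarrow> complex"
  assumes "\<And>v w. L (v + w) = L v + L w" "\<And>c v. L (c *s v) = cnj c * L v"
  shows "L v = (\<Sum>\<mu>\<in>UNIV. cnj (v $ \<mu>) * L (axis \<mu> 1))"
proof -
  have "L 0 = 0" using assms(2)[of 0 0] by simp
  then have "L (\<Sum>\<mu>\<in>I. v $ \<mu> *s axis \<mu> 1) = (\<Sum>\<mu>\<in>I. cnj (v $ \<mu>) * L (axis \<mu> 1))" for I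
    by (induction I rule: infinite_finite_induct) (simp_all add: assms)
  then show ?thesis by (metis basis_expansion)
qed

lemma hermitian_form_sesquilinear:
  fixes \<phi> :: "complex^'n::finite \<Rightarrow> 'g::euclidean_space dual"
  assumes l1: "\<And>w. linear (\<lambda>v. pull_form br \<phi> z v w)" and l2: "\<And>v. linear (pull_form br \<phi> z v)"
    and inv: "\<And>v w. pull_form br \<phi> z (\<i> *s v) (\<i> *s w) = pull_form br \<phi> z v w"
  shows "hermitian_form br \<phi> z (v + v') w = hermitian_form br \<phi> z v w + hermitian_form br \<phi> z v' w"
    and "hermitian_form br \<phi> z v (w + w') = hermitian_form br \<phi> z v w + hermitian_form br \<phi> z v w'"
    and "hermitian_form br \<phi> z (c *s v) w = cnj c * hermitian_form br \<phi> z v w"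
    and "hermitian_form br \<phi> z v (c *s w) = c * hermitian_form br \<phi> z v w"
    and "omega br \<phi> z $ \<nu> $ \<mu> = hermitian_form br \<phi> z (axis \<nu> 1) (axis \<mu> 1)"
    and "Re (hermitian_form br \<phi> z v v) = pull_form br \<phi> z (\<i> *s v) v / 2"
proof -
  let ?P = "pull_form br \<phi> z"
  note lin = linear_add[OF l1] linear_add[OF l2] linear_scale[OF l1] linear_scale[OF l2]
    linear_neg[OF l1] linear_neg[OF l2] linear_diff[OF l2]
  have ii: "\<i> *s (\<i> *s v) = - v" for v :: "complex^'n"
    by (simp add: vec_eq_iff)
  have ic: "\<i> *s (c *s v) = Re c *\<^sub>R (\<i> *s v) + Im c *\<^sub>R (- v)" for v :: "complex^'n"
    unfolding complex_smult_eq[of c v] by (simp add: vec_eq_iff algebra_simps)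
  have swap: "?P (\<i> *s v) w = - ?P v (\<i> *s w)" for v w
    using inv[of "\<i> *s v" w] by (simp add: ii lin)
  show "hermitian_form br \<phi> z (v + v') w = hermitian_form br \<phi> z v w + hermitian_form br \<phi> z v' w"
    by (simp add: hermitian_form_def lin field_simps)
  show "hermitian_form br \<phi> z v (w + w') = hermitian_form br \<phi> z v w + hermitian_form br \<phi> z v w'"
    by (simp add: hermitian_form_def lin vector_add_ldistrib field_simps)
  show "hermitian_form br \<phi> z (c *s v) w = cnj c * hermitian_form br \<phi> z v w"
    unfolding hermitian_form_def complex_smult_eq[of c v]
    by (simp add: complex_eq_iff lin swap ii field_simps)
  show "hermitian_form br \<phi> z v (c *s w) = c * hermitian_form br \<phi> z v w"
  proof -
    have "?P v (c *s w) = Re c * ?P v w + Im c * ?P v (\<i> *s w)"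
      by (subst complex_smult_eq) (simp add: lin)
    moreover have "?P v (\<i> *s (c *s w)) = Re c * ?P v (\<i> *s w) - Im c * ?P v w"
      by (subst ic) (simp add: lin)
    ultimately show ?thesis
      by (simp add: hermitian_form_def complex_eq_iff field_simps)
  qed
  show "omega br \<phi> z $ \<nu> $ \<mu> = hermitian_form br \<phi> z (axis \<nu> 1) (axis \<mu> 1)"
    by (simp add: omega_def hermitian_form_def axis_imaginary inv swap ii lin complex_eq_iff)
  show "Re (hermitian_form br \<phi> z v v) = ?P (\<i> *s v) v / 2"
    by (simp add: hermitian_form_def swap)
qed

definition del :: "(complex^'n \<Rightarrow> complex) \<Rightarrow> complex^'n \<Rightarrow> complex^'n \<Rightarrow> complex" where
  "del f z v = (frechet_derivative f (at z) v - \<i> * frechet_derivative f (at z) (\<i> *s v)) / 2"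

definition delbar :: "(complex^'n \<Rightarrow> complex) \<Rightarrow> complex^'n \<Rightarrow> complex^'n \<Rightarrow> complex" where
  "delbar f z v = (frechet_derivative f (at z) v + \<i> * frechet_derivative f (at z) (\<i> *s v)) / 2"

lemma linear_complex_smult:
  fixes D :: "complex^'n::finite \<Rightarrow> complex"
  assumes "linear D"
  shows "D (c *s v) = Re c *\<^sub>R D v + Im c *\<^sub>R D (\<i> *s v)"
    and "D (\<i> *s (c *s v)) = Re c *\<^sub>R D (\<i> *s v) - Im c *\<^sub>R D v"
proof -
  show "D (c *s v) = Re c *\<^sub>R D v + Im c *\<^sub>R D (\<i> *s v)"
    by (subst complex_smult_eq) (simp add: linear_add[OF assms] linear_scale[OF assms])
  have "\<i> *s (c *s v) = Re c *\<^sub>R (\<i> *s v) + Im c *\<^sub>R (- v)"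
    unfolding complex_smult_eq[of c v] by (simp add: vec_eq_iff algebra_simps)
  then show "D (\<i> *s (c *s v)) = Re c *\<^sub>R D (\<i> *s v) - Im c *\<^sub>R D v"
    by (simp add: linear_add[OF assms] linear_scale[OF assms] linear_neg[OF assms] linear_diff[OF assms])
qed

lemma del_expansion:
  fixes f :: "complex^'n::finite \<Rightarrow> complex"
  assumes "f differentiable (at z)"
  shows "del f z v = (\<Sum>\<mu>\<in>UNIV. v $ \<mu> * dz \<mu> f z)"
proof -
  have lin: "linear (frechet_derivative f (at z))"
    using assms by (rule linear_frechet_derivative)
  have "del f z v = (\<Sum>\<mu>\<in>UNIV. v $ \<mu> * del f z (axis \<mu> 1))"
  proof (rule complex_linear_expansion)
    show "del f z (v + w) = del f z v + del f z w" for v w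
      by (simp add: del_def vector_add_ldistrib linear_add[OF lin] field_simps)
    show "del f z (c *s v) = c * del f z v" for c v
      unfolding del_def linear_complex_smult[OF lin, of c]
      by (simp add: complex_eq_iff field_simps)
  qed
  then show ?thesis by (simp add: del_def dz_def axis_imaginary)
qed

lemma delbar_expansion:
  fixes f :: "complex^'n::finite \<Rightarrow> complex"
  assumes "f differentiable (at z)"
  shows "delbar f z v = (\<Sum>\<nu>\<in>UNIV. cnj (v $ \<nu>) * dzbar \<nu> f z)"
proof -
  have lin: "linear (frechet_derivative f (at z))"
    using assms by (rule linear_frechet_derivative)
  have "delbar f z v = (\<Sum>\<nu>\<in>UNIV. cnj (v $ \<nu>) * delbar f z (axis \<nu> 1))"
  proof (rule complex_antilinear_expansion)
    show "delbar f z (v + w) = delbar f z v + delbar f z w" for v w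
      by (simp add: delbar_def vector_add_ldistrib linear_add[OF lin] field_simps)
    show "delbar f z (c *s v) = cnj c * delbar f z v" for c v
      unfolding delbar_def linear_complex_smult[OF lin, of c]
      by (simp add: complex_eq_iff field_simps)
  qed
  then show ?thesis by (simp add: delbar_def dzbar_def axis_imaginary)
qed

lemma hermitian_form_expansion:
  fixes \<phi> :: "complex^'n::finite \<Rightarrow> 'g::euclidean_space dual"
  assumes l1: "\<And>w. linear (\<lambda>v. pull_form br \<phi> z v w)" and l2: "\<And>v. linear (pull_form br \<phi> z v)"
    and inv: "\<And>v w. pull_form br \<phi> z (\<i> *s v) (\<i> *s w) = pull_form br \<phi> z v w"
  shows "hermitian_form br \<phi> z v w
    = (\<Sum>\<nu>\<in>UNIV. \<Sum>\<mu>\<in>UNIV. cnj (v $ \<nu>) * omega br \<phi> z $ \<nu> $ \<mu> * w $ \<mu>)"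
proof -
  note h = hermitian_form_sesquilinear[OF assms]
  have "hermitian_form br \<phi> z v w = (\<Sum>\<nu>\<in>UNIV. cnj (v $ \<nu>) * hermitian_form br \<phi> z (axis \<nu> 1) w)"
    by (rule complex_antilinear_expansion) (simp_all add: h)
  also have "\<dots> = (\<Sum>\<nu>\<in>UNIV. cnj (v $ \<nu>) *
      (\<Sum>\<mu>\<in>UNIV. w $ \<mu> * hermitian_form br \<phi> z (axis \<nu> 1) (axis \<mu> 1)))"
    by (subst complex_linear_expansion[of "hermitian_form br \<phi> z _" w]) (simp_all add: h)
  finally show ?thesis
    by (simp add: h(5) sum_distrib_left mult_ac)
qed

lemma matrix_inv_inverse:
  fixes W :: "complex^'n::finite^'n"
  assumes "invertible W"
  shows "W ** matrix_inv W = mat 1" "matrix_inv W ** W = mat 1"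
proof -
  have "W ** matrix_inv W = mat 1 \<and> matrix_inv W ** W = mat 1"
    using assms unfolding matrix_inv_def invertible_def by (rule someI_ex)
  then show "W ** matrix_inv W = mat 1" "matrix_inv W ** W = mat 1" by auto
qed

text \<open>A kernel vector \<open>v\<close> is a null vector of the Hermitian form, but the real part of the form at \<open>(v, v)\<close> is
  \<open>\<omega>\<^sub>0(iv, v) / 2\<close>.\<close>

lemma omega_invertible:
  fixes \<phi> :: "complex^'n::finite \<Rightarrow> 'g::euclidean_space dual"
  assumes l1: "\<And>w. linear (\<lambda>v. pull_form br \<phi> z v w)" and l2: "\<And>v. linear (pull_form br \<phi> z v)"
    and inv: "\<And>v w. pull_form br \<phi> z (\<i> *s v) (\<i> *s w) = pull_form br \<phi> z v w"
    and pos: "\<And>v. v \<noteq> 0 \<Longrightarrow> 0 < pull_form br \<phi> z (\<i> *s v) v"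
  shows "invertible (omega br \<phi> z)"
proof -
  have "v = 0" if "omega br \<phi> z *v v = 0" for v
  proof (rule ccontr)
    assume "v \<noteq> 0"
    have "hermitian_form br \<phi> z v v = (\<Sum>\<nu>\<in>UNIV. cnj (v $ \<nu>) * (omega br \<phi> z *v v) $ \<nu>)"
      unfolding hermitian_form_expansion[OF l1 l2 inv]
      by (simp add: matrix_vector_mult_def sum_distrib_left mult_ac)
    then have "Re (hermitian_form br \<phi> z v v) = 0" by (simp add: that)
    then show False
      using hermitian_form_sesquilinear(6)[OF l1 l2 inv, of v] pos[OF \<open>v \<noteq> 0\<close>] by simp
  qed
  then obtain B where "B ** omega br \<phi> z = mat 1"
    using matrix_left_invertible_ker[of "omega br \<phi> z"] by blast
  then show ?thesis
    using invertible_def matrix_left_right_inverse by blast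
qed

text \<open>The inverse matrix enters \<open>ad\<^sub>-(\<psi>)\<close> only through the vector \<open>c\<close> that the Hermitian form pairs to
  \<open>\<partial>\<psi>\<close>. In this form the operator makes no reference to coordinates.\<close>

lemma ad_minus_chart_eq_delbar:
  fixes \<phi> :: "complex^'n::finite \<Rightarrow> 'g::euclidean_space dual"
  assumes l1: "\<And>w. linear (\<lambda>v. pull_form br \<phi> z v w)" and l2: "\<And>v. linear (pull_form br \<phi> z v)"
    and inv: "\<And>v w. pull_form br \<phi> z (\<i> *s v) (\<i> *s w) = pull_form br \<phi> z v w"
    and om: "invertible (omega br \<phi> z)"
    and \<psi>: "\<psi> differentiable (at z)" and \<rho>: "\<rho> differentiable (at z)"
    and c: "\<And>w. hermitian_form br \<phi> z c w = del \<psi> z w"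
  shows "ad_minus_chart br \<phi> \<psi> \<rho> z = \<i> * delbar \<rho> z c"
proof -
  let ?W = "omega br \<phi> z" and ?V = "matrix_inv (omega br \<phi> z)"
  have dz: "dz \<mu> \<psi> z = (\<Sum>\<nu>\<in>UNIV. cnj (c $ \<nu>) * ?W $ \<nu> $ \<mu>)" for \<mu>
  proof -
    have "dz \<mu> \<psi> z = del \<psi> z (axis \<mu> 1)"
      by (simp add: del_def dz_def axis_imaginary)
    also have "\<dots> = (\<Sum>\<nu>\<in>UNIV. \<Sum>\<kappa>\<in>UNIV. cnj (c $ \<nu>) * ?W $ \<nu> $ \<kappa> * axis \<mu> 1 $ \<kappa>)"
      by (simp add: c[symmetric] hermitian_form_expansion[OF l1 l2 inv])
    finally show ?thesis
      by (simp add: axis_def if_distrib cong: if_cong)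
  qed
  have inverse: "(\<Sum>\<mu>\<in>UNIV. ?W $ \<kappa> $ \<mu> * ?V $ \<mu> $ \<nu>) = (if \<kappa> = \<nu> then 1 else 0)" for \<kappa> \<nu>
    using matrix_inv_inverse(1)[OF om]
    by (simp add: matrix_matrix_mult_def mat_def vec_eq_iff)
  have swap: "(\<Sum>\<mu>\<in>UNIV. \<Sum>\<kappa>\<in>UNIV. cnj (c $ \<kappa>) * (?W $ \<kappa> $ \<mu> * ?V $ \<mu> $ \<nu>))
      = cnj (c $ \<nu>)" for \<nu>
    by (subst sum.swap) (simp add: sum_distrib_left[symmetric] inverse if_distrib cong: if_cong)
  have "(\<Sum>\<mu>\<in>UNIV. \<Sum>\<nu>\<in>UNIV. ?V $ \<mu> $ \<nu> * dz \<mu> \<psi> z * dzbar \<nu> \<rho> z)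
      = (\<Sum>\<nu>\<in>UNIV. (\<Sum>\<mu>\<in>UNIV. \<Sum>\<kappa>\<in>UNIV. cnj (c $ \<kappa>) * (?W $ \<kappa> $ \<mu> * ?V $ \<mu> $ \<nu>)) * dzbar \<nu> \<rho> z)"
    by (subst sum.swap) (simp add: dz sum_distrib_left sum_distrib_right mult_ac)
  also have "\<dots> = (\<Sum>\<nu>\<in>UNIV. cnj (c $ \<nu>) * dzbar \<nu> \<rho> z)"
    by (simp only: swap)
  finally show ?thesis
    by (simp add: ad_minus_chart_def delbar_expansion[OF \<rho>])
qed

lemma hermitian_dual_vector_exists:
  fixes \<phi> :: "complex^'n::finite \<Rightarrow> 'g::euclidean_space dual"
  assumes l1: "\<And>w. linear (\<lambda>v. pull_form br \<phi> z v w)" and l2: "\<And>v. linear (pull_form br \<phi> z v)"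
    and inv: "\<And>v w. pull_form br \<phi> z (\<i> *s v) (\<i> *s w) = pull_form br \<phi> z v w"
    and om: "invertible (omega br \<phi> z)" and \<psi>: "\<psi> differentiable (at z)"
  obtains c where "\<And>w. hermitian_form br \<phi> z c w = del \<psi> z w"
proof
  let ?W = "omega br \<phi> z" and ?V = "matrix_inv (omega br \<phi> z)"
  fix w
  have inverse: "(\<Sum>\<nu>\<in>UNIV. ?V $ \<kappa> $ \<nu> * ?W $ \<nu> $ \<mu>) = (if \<kappa> = \<mu> then 1 else 0)" for \<kappa> \<mu>
    using matrix_inv_inverse(2)[OF om]
    by (simp add: matrix_matrix_mult_def mat_def vec_eq_iff)
  have swap: "(\<Sum>\<nu>\<in>UNIV. \<Sum>\<kappa>\<in>UNIV. dz \<kappa> \<psi> z * (?V $ \<kappa> $ \<nu> * ?W $ \<nu> $ \<mu>)) = dz \<mu> \<psi> z" for \<mu>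
    by (subst sum.swap) (simp add: sum_distrib_left[symmetric] inverse if_distrib cong: if_cong)
  have "hermitian_form br \<phi> z (\<chi> \<nu>. cnj (\<Sum>\<kappa>\<in>UNIV. dz \<kappa> \<psi> z * ?V $ \<kappa> $ \<nu>)) w
      = (\<Sum>\<mu>\<in>UNIV. (\<Sum>\<nu>\<in>UNIV. \<Sum>\<kappa>\<in>UNIV. dz \<kappa> \<psi> z * (?V $ \<kappa> $ \<nu> * ?W $ \<nu> $ \<mu>)) * w $ \<mu>)"
    unfolding hermitian_form_expansion[OF l1 l2 inv]
    by (subst sum.swap) (simp add: sum_distrib_left sum_distrib_right mult_ac)
  also have "\<dots> = (\<Sum>\<mu>\<in>UNIV. w $ \<mu> * dz \<mu> \<psi> z)"
    by (simp only: swap mult.commute[of "w $ _"])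
  also have "\<dots> = del \<psi> z w" by (simp add: del_expansion[OF \<psi>])
  finally show "hermitian_form br \<phi> z (\<chi> \<nu>. cnj (\<Sum>\<kappa>\<in>UNIV. dz \<kappa> \<psi> z * ?V $ \<kappa> $ \<nu>)) w = del \<psi> z w" .
qed

lemma smooth_on_det:
  fixes W :: "'a::real_normed_vector \<Rightarrow> complex^'n::finite^'n"
  assumes "open S" "\<And>i j. smooth_on S (\<lambda>z. W z $ i $ j)"
  shows "smooth_on S (\<lambda>z. det (W z))"
  unfolding det_def
  by (rule smooth_on_sum[OF assms(1)], rule smooth_on_mult, rule smooth_on_const[OF assms(1)],
      rule smooth_on_prod[OF assms(1)], rule assms(2))

text \<open>Cramer's rule writes the entries as quotients of determinants.\<close>

lemma smooth_on_matrix_inv: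
  fixes W :: "'a::real_normed_vector \<Rightarrow> complex^'n::finite^'n"
  assumes "open S" "\<And>i j. smooth_on S (\<lambda>z. W z $ i $ j)" "\<And>z. z \<in> S \<Longrightarrow> invertible (W z)"
  shows "smooth_on S (\<lambda>z. matrix_inv (W z) $ \<mu> $ \<nu>)"
proof -
  define C where "C z = (\<chi> i j. if j = \<mu> then axis \<nu> 1 $ i else W z $ i $ j)" for z
  have eq: "matrix_inv (W z) $ \<mu> $ \<nu> = det (C z) * inverse (det (W z))" if "z \<in> S" for z
  proof -
    have "W z *v (matrix_inv (W z) *v axis \<nu> 1) = axis \<nu> 1"
      by (simp add: matrix_vector_mul_assoc matrix_inv_inverse(1) assms(3)[OF that])
    then have "matrix_inv (W z) *v axis \<nu> 1
        = (\<chi> k. det (\<chi> i j. if j = k then axis \<nu> 1 $ i else W z $ i $ j) / det (W z))"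
      using cramer assms(3)[OF that] invertible_det_nz by blast
    then have "(matrix_inv (W z) *v axis \<nu> 1) $ \<mu> = det (C z) / det (W z)"
      by (simp add: C_def)
    moreover have "(matrix_inv (W z) *v axis \<nu> 1) $ \<mu> = matrix_inv (W z) $ \<mu> $ \<nu>"
      by (simp add: matrix_vector_mult_def axis_def if_distrib cong: if_cong)
    ultimately show ?thesis by (simp add: divide_inverse)
  qed
  have "smooth_on S (\<lambda>z. det (C z))"
  proof (rule smooth_on_det[OF assms(1)])
    show "smooth_on S (\<lambda>z. C z $ i $ j)" for i j
      using assms by (cases "j = \<mu>") (simp_all add: C_def smooth_on_const)
  qed
  moreover have "smooth_on S (\<lambda>z. inverse (det (W z)))"
    using assms by (intro smooth_on_inverse smooth_on_det) (auto simp: invertible_det_nz)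
  ultimately have "smooth_on S (\<lambda>z. det (C z) * inverse (det (W z)))"
    by (rule smooth_on_mult)
  moreover have "smooth_on S (\<lambda>z. matrix_inv (W z) $ \<mu> $ \<nu>)
      \<longleftrightarrow> smooth_on S (\<lambda>z. det (C z) * inverse (det (W z)))"
    by (rule smooth_on_cong) (rule eq)
  ultimately show ?thesis by simp
qed

section \<open>Kernels of square-summable families\<close>

text \<open>Dini's theorem: the finite partial sums increase to a continuous limit, so near each point one finite
  subfamily has a small tail, and compactness combines finitely many of these.\<close>

lemma square_sum_uniform_tail:
  fixes \<alpha> :: "'u \<Rightarrow> 'a::metric_space \<Rightarrow> complex"
  assumes sum: "\<And>p. p \<in> C \<Longrightarrow> ((\<lambda>u. (cmod (\<alpha> u p))\<^sup>2) has_sum E p) B"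
    and C: "compact C" and E: "continuous_on C E"
    and \<alpha>: "\<And>u. u \<in> B \<Longrightarrow> continuous_on C (\<alpha> u)" and \<epsilon>: "0 < \<epsilon>"
  shows "\<exists>F. finite F \<and> F \<subseteq> B \<and> (\<forall>p\<in>C. E p - (\<Sum>u\<in>F. (cmod (\<alpha> u p))\<^sup>2) < \<epsilon>)"
proof -
  define tail where "tail F p = E p - (\<Sum>u\<in>F. (cmod (\<alpha> u p))\<^sup>2)" for F p
  have cont: "continuous_on C (tail F)" if "F \<subseteq> B" for F
    unfolding tail_def using that by (intro continuous_intros E \<alpha>) auto
  have "\<exists>F N. finite F \<and> F \<subseteq> B \<and> open N \<and> p \<in> N \<and> (\<forall>q\<in>C \<inter> N. tail F q < \<epsilon>)" if p: "p \<in> C" for p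
  proof -
    have "eventually (\<lambda>F. dist (\<Sum>u\<in>F. (cmod (\<alpha> u p))\<^sup>2) (E p) < \<epsilon>) (finite_subsets_at_top B)"
      using sum[OF p] \<epsilon> unfolding has_sum_def by (rule tendstoD)
    then obtain F where F: "finite F" "F \<subseteq> B" "dist (\<Sum>u\<in>F. (cmod (\<alpha> u p))\<^sup>2) (E p) < \<epsilon>"
      unfolding eventually_finite_subsets_at_top by blast
    have "tail F p < \<epsilon>" using F(3) by (simp add: tail_def dist_real_def)
    moreover have "open {..<\<epsilon>}" by simp
    ultimately obtain N where "open N" "N \<inter> C = tail F -` {..<\<epsilon>} \<inter> C"
      using cont[OF F(2)] unfolding continuous_on_open_invariant by metis
    then have "p \<in> N" "\<forall>q\<in>C \<inter> N. tail F q < \<epsilon>"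
      using p \<open>tail F p < \<epsilon>\<close> by auto
    then show ?thesis
      using F(1,2) \<open>open N\<close> by blast
  qed
  then have "\<forall>p\<in>C. \<exists>W. finite (fst W) \<and> fst W \<subseteq> B \<and> open (snd W) \<and> p \<in> snd W
      \<and> (\<forall>q\<in>C \<inter> snd W. tail (fst W) q < \<epsilon>)" by simp
  from bchoice[OF this] obtain W where W: "\<forall>p\<in>C. finite (fst (W p)) \<and> fst (W p) \<subseteq> B
      \<and> open (snd (W p)) \<and> p \<in> snd (W p) \<and> (\<forall>q\<in>C \<inter> snd (W p). tail (fst (W p)) q < \<epsilon>)" by (rule exE)
  define F N where "F p = fst (W p)" and "N p = snd (W p)" for p
  have FO: "\<And>p. p \<in> C \<Longrightarrow> finite (F p) \<and> F p \<subseteq> B"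
    "\<And>p. p \<in> C \<Longrightarrow> open (N p)" "\<And>p. p \<in> C \<Longrightarrow> p \<in> N p"
    "\<And>p q. p \<in> C \<Longrightarrow> q \<in> C \<Longrightarrow> q \<in> N p \<Longrightarrow> tail (F p) q < \<epsilon>"
    using W by (auto simp: F_def N_def)
  obtain P where P: "P \<subseteq> C" "finite P" "C \<subseteq> (\<Union>p\<in>P. N p)"
  proof (rule compactE_image[OF C, of C N])
    show "open (N p)" if "p \<in> C" for p using FO(2) that by simp
    show "C \<subseteq> (\<Union>p\<in>C. N p)" using FO(3) by auto
  qed
  have "tail (\<Union>p\<in>P. F p) q < \<epsilon>" if q: "q \<in> C" for q
  proof -
    obtain p where p: "p \<in> P" "q \<in> N p" using P q by blast
    have "(\<Sum>u\<in>F p. (cmod (\<alpha> u q))\<^sup>2) \<le> (\<Sum>u\<in>(\<Union>p\<in>P. F p). (cmod (\<alpha> u q))\<^sup>2)"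
      using P FO(1) p by (intro sum_mono2) auto
    then have "tail (\<Union>p\<in>P. F p) q \<le> tail (F p) q" by (simp add: tail_def)
    also have "\<dots> < \<epsilon>" using P(1) p q by (intro FO(4)) auto
    finally show ?thesis .
  qed
  moreover have "finite (\<Union>p\<in>P. F p)" "(\<Union>p\<in>P. F p) \<subseteq> B" using P FO(1) by auto
  ultimately show ?thesis unfolding tail_def by blast
qed

text \<open>The tail of the product is dominated by \<open>\<bar>ab\<bar> \<le> (\<bar>a\<bar>\<^sup>2 + \<bar>b\<bar>\<^sup>2) / 2\<close>.\<close>

lemma kernel_partial_sum_bound:
  fixes a b :: "'u \<Rightarrow> complex"
  assumes a: "((\<lambda>u. (cmod (a u))\<^sup>2) has_sum A) B" and b: "((\<lambda>u. (cmod (b u))\<^sup>2) has_sum A') B"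
    and F: "finite F" "F \<subseteq> B"
  shows "cmod ((\<Sum>\<^sub>\<infinity>u\<in>B. a u * b u) - (\<Sum>u\<in>F. a u * b u))
    \<le> ((A - (\<Sum>u\<in>F. (cmod (a u))\<^sup>2)) + (A' - (\<Sum>u\<in>F. (cmod (b u))\<^sup>2))) / 2"
proof -
  have le: "cmod (a u * b u) \<le> ((cmod (a u))\<^sup>2 + (cmod (b u))\<^sup>2) * (1/2)" for u
    using sum_squares_bound[of "cmod (a u)" "cmod (b u)"] by (simp add: norm_mult)
  have AB: "((\<lambda>u. ((cmod (a u))\<^sup>2 + (cmod (b u))\<^sup>2) * (1/2)) has_sum (A + A') * (1/2)) B"
    by (intro has_sum_cmult_left has_sum_add a b)
  have fin: "((\<lambda>u. g u) has_sum (\<Sum>u\<in>F. g u)) F" for g :: "'u \<Rightarrow> 'c::{comm_monoid_add,topological_space}"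
    using F(1) by (rule has_sum_finite)
  have norms: "(\<lambda>u. cmod (a u * b u)) summable_on C" if "C \<subseteq> B" for C
    by (rule Infinite_Sum.abs_summable_on_comparison_test'[OF
          summable_on_subset_banach[OF has_sum_imp_summable[OF AB] that] le])
  have "(\<lambda>u. a u * b u) summable_on B" by (rule abs_summable_summable[OF norms[OF subset_refl]])
  from has_sum_infsum[OF this]
  have diff: "((\<lambda>u. a u * b u) has_sum ((\<Sum>\<^sub>\<infinity>u\<in>B. a u * b u) - (\<Sum>u\<in>F. a u * b u))) (B - F)"
    by (rule has_sum_Diff[OF _ fin F(2)])
  have "cmod ((\<Sum>\<^sub>\<infinity>u\<in>B. a u * b u) - (\<Sum>u\<in>F. a u * b u))
      \<le> (\<Sum>\<^sub>\<infinity>u\<in>B - F. cmod (a u * b u))"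
    by (rule norm_has_sum_bound[OF has_sum_infsum[OF norms] diff]) auto
  also have "\<dots> \<le> (A + A') * (1/2) - (\<Sum>u\<in>F. ((cmod (a u))\<^sup>2 + (cmod (b u))\<^sup>2) * (1/2))"
    by (rule has_sum_mono[OF has_sum_infsum[OF norms] has_sum_Diff[OF AB fin F(2)]]) (use le in auto)
  also have "\<dots> = ((A - (\<Sum>u\<in>F. (cmod (a u))\<^sup>2)) + (A' - (\<Sum>u\<in>F. (cmod (b u))\<^sup>2))) / 2"
    unfolding sum_distrib_right[symmetric] sum.distrib by (simp add: field_simps)
  finally show ?thesis .
qed

text \<open>The families may be uncountable, but near each point finite subfamilies approximate the kernel
  uniformly, and a sequence of these is enough for Weierstrass' theorem.\<close>

lemma J_holomorphic_kernel:
  fixes \<alpha> \<beta> :: "'u \<Rightarrow> 'a::euclidean_space \<Rightarrow> complex"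
  assumes \<alpha>: "\<And>p. p \<in> S \<Longrightarrow> ((\<lambda>u. (cmod (\<alpha> u p))\<^sup>2) has_sum E p) B" "continuous_on S E"
      "\<And>u. u \<in> B \<Longrightarrow> continuous_on S (\<alpha> u)"
    and \<beta>: "\<And>p. p \<in> S \<Longrightarrow> ((\<lambda>u. (cmod (\<beta> u p))\<^sup>2) has_sum E' p) B" "continuous_on S E'"
      "\<And>u. u \<in> B \<Longrightarrow> continuous_on S (\<beta> u)"
    and S: "open S" and J: "\<And>v. norm (J v) \<le> norm v"
    and hol: "\<And>u. u \<in> B \<Longrightarrow> J_holomorphic J S (\<lambda>p. \<alpha> u p * \<beta> u p)"
  shows "J_holomorphic J S (\<lambda>p. \<Sum>\<^sub>\<infinity>u\<in>B. \<alpha> u p * \<beta> u p)"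
  unfolding J_holomorphic_def
proof (intro conjI ballI)
  show "open S" by (rule S)
  fix p assume "p \<in> S"
  then obtain r where r: "0 < r" "cball p r \<subseteq> S"
    using S open_contains_cball by blast
  define approx where "approx n F \<longleftrightarrow> finite F \<and> F \<subseteq> B \<and> (\<forall>q\<in>cball p r.
      cmod ((\<Sum>\<^sub>\<infinity>u\<in>B. \<alpha> u q * \<beta> u q) - (\<Sum>u\<in>F. \<alpha> u q * \<beta> u q)) < 1 / real (Suc n))" for n F
  have "\<exists>F. approx n F" for n
  proof -
    define \<epsilon> where "\<epsilon> = 1 / real (Suc n)"
    have \<epsilon>: "0 < \<epsilon>" by (simp add: \<epsilon>_def)
    have "\<exists>F. finite F \<and> F \<subseteq> B \<and> (\<forall>q\<in>cball p r. E q - (\<Sum>u\<in>F. (cmod (\<alpha> u q))\<^sup>2) < \<epsilon>)"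
      using r(2) by (intro square_sum_uniform_tail \<alpha>(1) continuous_on_subset[OF \<alpha>(2)]
          continuous_on_subset[OF \<alpha>(3)] \<epsilon>) auto
    then obtain F where F: "finite F" "F \<subseteq> B"
      "\<And>q. q \<in> cball p r \<Longrightarrow> E q - (\<Sum>u\<in>F. (cmod (\<alpha> u q))\<^sup>2) < \<epsilon>" by blast
    have "\<exists>F. finite F \<and> F \<subseteq> B \<and> (\<forall>q\<in>cball p r. E' q - (\<Sum>u\<in>F. (cmod (\<beta> u q))\<^sup>2) < \<epsilon>)"
      using r(2) by (intro square_sum_uniform_tail \<beta>(1) continuous_on_subset[OF \<beta>(2)]
          continuous_on_subset[OF \<beta>(3)] \<epsilon>) auto
    then obtain F' where F': "finite F'" "F' \<subseteq> B"
      "\<And>q. q \<in> cball p r \<Longrightarrow> E' q - (\<Sum>u\<in>F'. (cmod (\<beta> u q))\<^sup>2) < \<epsilon>" by blast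
    have "cmod ((\<Sum>\<^sub>\<infinity>u\<in>B. \<alpha> u q * \<beta> u q) - (\<Sum>u\<in>F \<union> F'. \<alpha> u q * \<beta> u q)) < \<epsilon>"
      if q: "q \<in> cball p r" for q
    proof -
      have "(\<Sum>u\<in>F. (cmod (\<alpha> u q))\<^sup>2) \<le> (\<Sum>u\<in>F \<union> F'. (cmod (\<alpha> u q))\<^sup>2)"
        "(\<Sum>u\<in>F'. (cmod (\<beta> u q))\<^sup>2) \<le> (\<Sum>u\<in>F \<union> F'. (cmod (\<beta> u q))\<^sup>2)"
        using F F' by (auto intro!: sum_mono2)
      moreover have "cmod ((\<Sum>\<^sub>\<infinity>u\<in>B. \<alpha> u q * \<beta> u q) - (\<Sum>u\<in>F \<union> F'. \<alpha> u q * \<beta> u q))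
          \<le> ((E q - (\<Sum>u\<in>F \<union> F'. (cmod (\<alpha> u q))\<^sup>2)) + (E' q - (\<Sum>u\<in>F \<union> F'. (cmod (\<beta> u q))\<^sup>2))) / 2"
        using q r F F' by (intro kernel_partial_sum_bound \<alpha>(1) \<beta>(1)) auto
      ultimately show ?thesis
        using F(3)[OF q] F'(3)[OF q] by argo
    qed
    then show ?thesis
      unfolding approx_def \<epsilon>_def[symmetric] using F F' by (intro exI[of _ "F \<union> F'"]) auto
  qed
  then obtain F where "approx n (F n)" for n by metis
  then have F: "\<And>n. finite (F n)" "\<And>n. F n \<subseteq> B"
    "\<And>n q. q \<in> cball p r \<Longrightarrow>
      cmod ((\<Sum>\<^sub>\<infinity>u\<in>B. \<alpha> u q * \<beta> u q) - (\<Sum>u\<in>F n. \<alpha> u q * \<beta> u q)) < 1 / real (Suc n)"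
    by (auto simp: approx_def)
  have "uniform_limit (ball p r) (\<lambda>n q. \<Sum>u\<in>F n. \<alpha> u q * \<beta> u q)
      (\<lambda>q. \<Sum>\<^sub>\<infinity>u\<in>B. \<alpha> u q * \<beta> u q) sequentially"
  proof (rule uniform_limitI)
    fix e :: real assume "0 < e"
    from order_tendstoD(2)[OF LIMSEQ_Suc[OF lim_1_over_n] this]
    show "\<forall>\<^sub>F n in sequentially. \<forall>q\<in>ball p r.
        dist (\<Sum>u\<in>F n. \<alpha> u q * \<beta> u q) (\<Sum>\<^sub>\<infinity>u\<in>B. \<alpha> u q * \<beta> u q) < e"
    proof eventually_elim
      case (elim n)
      show ?case
      proof
        fix q assume "q \<in> ball p r"
        then have "q \<in> cball p r" by simp
        from less_trans[OF F(3)[OF this] elim]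
        show "dist (\<Sum>u\<in>F n. \<alpha> u q * \<beta> u q) (\<Sum>\<^sub>\<infinity>u\<in>B. \<alpha> u q * \<beta> u q) < e"
          by (simp only: dist_norm norm_minus_commute)
      qed
    qed
  qed
  moreover have "J_holomorphic J (ball p r) (\<lambda>q. \<Sum>u\<in>F n. \<alpha> u q * \<beta> u q)" for n
    using r F(2)
    by (intro J_holomorphic_sum J_holomorphic_subset[OF hol]) (auto simp: subset_eq)
  ultimately show "\<exists>D. ((\<lambda>p. \<Sum>\<^sub>\<infinity>u\<in>B. \<alpha> u p * \<beta> u p) has_derivative D) (at p)
      \<and> (\<forall>v. D (J v) = \<i> * D v)"
    by (intro J_holomorphic_uniform_limit[OF _ J r(1)])
qed

section \<open>First-order operators in the antiholomorphic directions\<close>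

text \<open>The shape of \<open>x\<^sup>j - i hbar ad\<^sub>-(x\<^sup>j)\<close> in a chart: the antiholomorphic derivatives are the only ones
  that occur.\<close>

definition dbar_op ::
  "(complex^'n::finite \<Rightarrow> complex) \<Rightarrow> ('n \<Rightarrow> complex^'n \<Rightarrow> complex)
     \<Rightarrow> (complex^'n \<Rightarrow> complex) \<Rightarrow> complex^'n \<Rightarrow> complex" where
  "dbar_op x \<beta> \<rho> z = x z * \<rho> z + (\<Sum>\<nu>\<in>UNIV. \<beta> \<nu> z * dzbar \<nu> \<rho> z)"

lemma dzbar_cong:
  assumes "open U" "z \<in> U" "\<And>y. y \<in> U \<Longrightarrow> f y = g y"
  shows "dzbar \<nu> f z = dzbar \<nu> g z"
  by (simp add: dzbar_def frechet_derivative_cong_open[OF assms])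

lemma dbar_op_cong:
  assumes "open U" "z \<in> U" "\<And>y. y \<in> U \<Longrightarrow> f y = g y"
  shows "dbar_op x \<beta> f z = dbar_op x \<beta> g z"
  using assms by (simp add: dbar_op_def dzbar_cong[OF assms])

lemma dzbar_mult:
  assumes "f differentiable (at z)" "g differentiable (at z)"
  shows "dzbar \<nu> (\<lambda>z. f z * g z) z = dzbar \<nu> f z * g z + f z * dzbar \<nu> g z"
proof -
  have "frechet_derivative (\<lambda>z. f z * g z) (at z)
      = (\<lambda>v. f z * frechet_derivative g (at z) v + frechet_derivative f (at z) v * g z)"
    by (intro frechet_derivative_eqI has_derivative_mult)
      (use assms in \<open>simp_all add: frechet_derivative_works[symmetric]\<close>)
  then show ?thesis by (simp add: dzbar_def field_simps)
qed

lemma dzbar_add: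
  assumes "f differentiable (at z)" "g differentiable (at z)"
  shows "dzbar \<nu> (\<lambda>z. f z + g z) z = dzbar \<nu> f z + dzbar \<nu> g z"
proof -
  have "frechet_derivative (\<lambda>z. f z + g z) (at z)
      = (\<lambda>v. frechet_derivative f (at z) v + frechet_derivative g (at z) v)"
    by (intro frechet_derivative_eqI has_derivative_add)
      (use assms in \<open>simp_all add: frechet_derivative_works[symmetric]\<close>)
  then show ?thesis by (simp add: dzbar_def field_simps)
qed

lemma dzbar_exp:
  assumes "f differentiable (at z)"
  shows "dzbar \<nu> (\<lambda>z. exp (f z)) z = exp (f z) * dzbar \<nu> f z"
proof -
  have "((\<lambda>z. exp (f z)) has_derivative (\<lambda>v. exp (f z) * frechet_derivative f (at z) v)) (at z)"
    by (rule has_derivative_compose[OF assms[unfolded frechet_derivative_works]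
          DERIV_exp[unfolded has_field_derivative_def]])
  from frechet_derivative_eqI[OF this] show ?thesis
    by (simp add: dzbar_def field_simps)
qed

lemma smooth_on_dbar_op:
  assumes "smooth_on U x" "\<And>\<nu>. smooth_on U (\<beta> \<nu>)" "smooth_on U \<rho>"
  shows "smooth_on U (dbar_op x \<beta> \<rho>)"
proof -
  have "smooth_on U (\<lambda>z. x z * \<rho> z + (\<Sum>\<nu>\<in>UNIV. \<beta> \<nu> z * dzbar \<nu> \<rho> z))"
    by (rule smooth_on_add, rule smooth_on_mult[OF assms(1,3)],
        rule smooth_on_sum[OF smooth_on_open[OF assms(1)]], rule smooth_on_mult[OF assms(2)],
        rule smooth_on_dzbar[OF assms(3)])
  moreover have "dbar_op x \<beta> \<rho> = (\<lambda>z. x z * \<rho> z + (\<Sum>\<nu>\<in>UNIV. \<beta> \<nu> z * dzbar \<nu> \<rho> z))"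
    by (rule ext) (rule dbar_op_def)
  ultimately show ?thesis by simp
qed

definition polar_J :: "(complex^'n::finite) \<times> (complex^'n) \<Rightarrow> (complex^'n) \<times> (complex^'n)" where
  "polar_J v = ((- \<i>) *s fst v, \<i> *s snd v)"

lemma norm_smult_complex:
  fixes v :: "complex^'n::finite"
  shows "norm (c *s v) = cmod c * norm v"
  by (simp add: norm_vec_def norm_mult L2_set_right_distrib)

lemma norm_polar_J: "norm (polar_J v) \<le> norm v"
  by (cases v) (simp add: polar_J_def norm_Pair norm_smult_complex)

text \<open>A class of functions of two points that contains \<open>exp(-F\<^sub>0(z)/hbar) \<K>\<^sup>#(z|w)\<close> and is mapped to itself by
  the operators acting on \<open>z\<close>. Keeping the smooth factor \<open>a(z)\<close> apart from \<open>H\<close> makes holomorphy in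
  \<open>w\<close> survive differentiation in \<open>z\<close>: the derivatives of \<open>H\<close> are again \<open>J\<close>-holomorphic.\<close>

inductive polarized ::
  "(complex^'n::finite) set \<Rightarrow> (complex^'n \<Rightarrow> complex^'n \<Rightarrow> complex) \<Rightarrow> bool" for U where
  prod: "smooth_on U a \<Longrightarrow> J_holomorphic polar_J (U \<times> U) H \<Longrightarrow> polarized U (\<lambda>z w. a z * H (z, w))"
| add: "polarized U G \<Longrightarrow> polarized U G' \<Longrightarrow> polarized U (\<lambda>z w. G z w + G' z w)"

lemma J_holomorphic_slice_derivatives:
  assumes H: "J_holomorphic polar_J (U \<times> V) H" and z: "z \<in> U" and w: "w \<in> V"
  defines "D \<equiv> frechet_derivative H (at (z, w))"
  shows "((\<lambda>z. H (z, w)) has_derivative (\<lambda>v. D (v, 0))) (at z)"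
    and "z = w \<Longrightarrow> ((\<lambda>z. H (z, z)) has_derivative (\<lambda>v. D (v, 0) + D (0, v))) (at z)"
    and "D (0, \<i> *s v) = \<i> * D (0, v)"
    and "D ((- \<i>) *s v, 0) = \<i> * D (v, 0)"
proof -
  have D: "(H has_derivative D) (at (z, w))" and J: "D (polar_J u) = \<i> * D u" for u
    using J_holomorphicD[OF H, of "(z, w)"] z w by (auto simp: D_def)
  have "((\<lambda>z. (z, w)) has_derivative (\<lambda>v. (v, 0))) (at z)"
    by (auto intro!: derivative_eq_intros)
  from has_derivative_compose[OF this D]
  show "((\<lambda>z. H (z, w)) has_derivative (\<lambda>v. D (v, 0))) (at z)" .
  show "D (0, \<i> *s v) = \<i> * D (0, v)"
    using J[of "(0, v)"] by (simp add: polar_J_def)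
  show "D ((- \<i>) *s v, 0) = \<i> * D (v, 0)"
    using J[of "(v, 0)"] by (simp add: polar_J_def)
  assume "z = w"
  have "((\<lambda>z. (z, z)) has_derivative (\<lambda>v. (v, v))) (at w)"
    by (auto intro!: derivative_eq_intros)
  from has_derivative_compose[OF this] D \<open>z = w\<close>
  have "((\<lambda>z. H (z, z)) has_derivative (\<lambda>v. D (v, v))) (at z)" by blast
  moreover have "D (v, v) = D (v, 0) + D (0, v)" for v
    using linear_add[OF has_derivative_linear[OF D], of "(v, 0)" "(0, v)"] by simp
  ultimately show "((\<lambda>z. H (z, z)) has_derivative (\<lambda>v. D (v, 0) + D (0, v))) (at z)" by simp
qed

text \<open>The total derivative of \<open>z \<mapsto> H(z, z)\<close> is the sum of the two partial ones, and the second has no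
  antiholomorphic part.\<close>

lemma polarized_diagonal:
  assumes "polarized U G" "z \<in> U" "w \<in> U"
  shows "(\<lambda>z. G z w) differentiable (at z)"
    and "(\<lambda>z. G z z) differentiable (at z)"
    and "dzbar \<nu> (\<lambda>z. G z z) z = dzbar \<nu> (\<lambda>y. G y z) z"
proof -
  have "(\<lambda>z. G z w) differentiable (at z) \<and> (\<lambda>z. G z z) differentiable (at z)
      \<and> dzbar \<nu> (\<lambda>z. G z z) z = dzbar \<nu> (\<lambda>y. G y z) z"
    using assms
  proof (induction arbitrary: z w)
    case (prod a H)
    note H = J_holomorphic_slice_derivatives[OF prod(2)]
    have a: "a differentiable (at z)" using prod smooth_on_differentiable by blast
    have d1: "(\<lambda>z. H (z, w)) differentiable (at z)" if "w \<in> U" for w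
      using H(1)[OF \<open>z \<in> U\<close> that] by (auto simp: differentiable_def)
    have d2: "(\<lambda>z. H (z, z)) differentiable (at z)"
      using H(2)[OF \<open>z \<in> U\<close> \<open>z \<in> U\<close> refl] by (auto simp: differentiable_def)
    have "dzbar \<nu> (\<lambda>z. H (z, z)) z = dzbar \<nu> (\<lambda>y. H (y, z)) z"
      using H(3)[OF \<open>z \<in> U\<close> \<open>z \<in> U\<close>, of "axis \<nu> 1"]
      by (simp add: dzbar_def frechet_derivative_eqI[OF H(2)[OF \<open>z \<in> U\<close> \<open>z \<in> U\<close> refl]]
          frechet_derivative_eqI[OF H(1)[OF \<open>z \<in> U\<close> \<open>z \<in> U\<close>]] axis_imaginary algebra_simps)
    then show ?case
      using prod.prems by (simp add: dzbar_mult a d1 d2 differentiable_mult)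
  next
    case (add G G')
    then show ?case
      by (simp add: dzbar_add differentiable_add)
  qed
  then show "(\<lambda>z. G z w) differentiable (at z)"
    and "(\<lambda>z. G z z) differentiable (at z)"
    and "dzbar \<nu> (\<lambda>z. G z z) z = dzbar \<nu> (\<lambda>y. G y z) z" by auto
qed

lemma polarized_sum:
  assumes "open U" "\<And>i. i \<in> I \<Longrightarrow> polarized U (G i)"
  shows "polarized U (\<lambda>z w. \<Sum>i\<in>I. G i z w)"
proof -
  have "polarized U (\<lambda>z w. 0 * (\<lambda>_. 0) (z, w))"
    using assms(1)
    by (intro prod[of U "\<lambda>_. 0"] smooth_on_const J_holomorphic_const open_Times)
  then have zero: "polarized U (\<lambda>z w. 0)" by simp
  show ?thesis
    using assms(2) by (induction I rule: infinite_finite_induct) (auto intro: zero add)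
qed

lemma polarized_dbar_op:
  assumes "polarized U G" and U: "open U" and x: "smooth_on U x" and \<beta>: "\<And>\<nu>. smooth_on U (\<beta> \<nu>)"
  shows "\<exists>G'. polarized U G' \<and> (\<forall>z\<in>U. \<forall>w\<in>U. G' z w = dbar_op x \<beta> (\<lambda>z. G z w) z)"
  using assms(1)
proof induction
  case (prod a H)
  note H = J_holomorphic_slice_derivatives[OF prod(2)]
  define H' where "H' \<nu> p = (frechet_derivative H (at p) (axis \<nu> 1, 0)
      + \<i> * frechet_derivative H (at p) (axis \<nu> \<i>, 0)) * (1 / 2)" for \<nu> p
  have H': "J_holomorphic polar_J (U \<times> U) (H' \<nu>)" for \<nu>
  proof -
    have "H' \<nu> = (\<lambda>p. (frechet_derivative H (at p) (axis \<nu> 1, 0)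
      - (- \<i>) * frechet_derivative H (at p) (axis \<nu> \<i>, 0)) * (1 / 2))"
      by (auto simp: H'_def)
    then show ?thesis
      using U
      by (simp only:) (intro J_holomorphic_mult J_holomorphic_diff J_holomorphic_const
          J_holomorphic_derivative[OF prod(2) norm_polar_J] open_Times)
  qed
  have eq: "dbar_op x \<beta> (\<lambda>z. a z * H (z, w)) z
      = dbar_op x \<beta> a z * H (z, w) + (\<Sum>\<nu>\<in>UNIV. \<beta> \<nu> z * a z * H' \<nu> (z, w))"
    if "z \<in> U" "w \<in> U" for z w
  proof -
    have a: "a differentiable (at z)" using prod(1) that smooth_on_differentiable by blast
    have d: "(\<lambda>z. H (z, w)) differentiable (at z)"
      using H(1)[OF that] by (auto simp: differentiable_def)
    have "dzbar \<nu> (\<lambda>z. H (z, w)) z = H' \<nu> (z, w)" for \<nu>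
      by (simp add: dzbar_def H'_def frechet_derivative_eqI[OF H(1)[OF that]])
    then show ?thesis
      by (simp add: dbar_op_def dzbar_mult[OF a d] algebra_simps sum.distrib sum_distrib_left)
  qed
  have "polarized U (\<lambda>z w. dbar_op x \<beta> a z * H (z, w) + (\<Sum>\<nu>\<in>UNIV. \<beta> \<nu> z * a z * H' \<nu> (z, w)))"
    (is "polarized U ?G")
    by (rule polarized.add, rule polarized.prod[OF smooth_on_dbar_op[OF x \<beta> prod(1)] prod(2)],
        rule polarized_sum[OF U], rule polarized.prod[OF smooth_on_mult[OF \<beta> prod(1)] H'])
  then show ?case
    by (intro exI[of _ ?G] conjI) (simp_all add: eq)
next
  case (add G1 G2)
  then obtain G1' G2' where G': "polarized U G1'" "polarized U G2'"
    "\<And>z w. z \<in> U \<Longrightarrow> w \<in> U \<Longrightarrow> G1' z w = dbar_op x \<beta> (\<lambda>z. G1 z w) z"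
    "\<And>z w. z \<in> U \<Longrightarrow> w \<in> U \<Longrightarrow> G2' z w = dbar_op x \<beta> (\<lambda>z. G2 z w) z" by blast
  have "dbar_op x \<beta> (\<lambda>z. G1 z w + G2 z w) z = G1' z w + G2' z w" if "z \<in> U" "w \<in> U" for z w
    using that polarized_diagonal(1)[OF add(1) that] polarized_diagonal(1)[OF add(2) that]
    by (simp add: G' dbar_op_def dzbar_add algebra_simps sum.distrib)
  then show ?case
    using polarized.add[OF G'(1,2)] by (intro exI[of _ "\<lambda>z w. G1' z w + G2' z w"] conjI) simp_all
qed

text \<open>Each application of an operator commutes with restriction to the diagonal and stays in the class of
  polarized functions.\<close>

lemma foldr_dbar_op_diagonal:
  assumes G: "polarized U G" and U: "open U"
    and x: "\<And>j. smooth_on U (x j)" and \<beta>: "\<And>j \<nu>. smooth_on U (\<beta> j \<nu>)" and z: "z \<in> U"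
  shows "foldr (\<lambda>j. dbar_op (x j) (\<beta> j)) js (\<lambda>z. G z z) z
    = foldr (\<lambda>j. dbar_op (x j) (\<beta> j)) js (\<lambda>y. G y z) z"
proof -
  let ?P = "foldr (\<lambda>j. dbar_op (x j) (\<beta> j))"
  have "\<exists>G'. polarized U G' \<and> (\<forall>z\<in>U. \<forall>w\<in>U. G' z w = ?P js (\<lambda>z. G z w) z)
      \<and> (\<forall>z\<in>U. G' z z = ?P js (\<lambda>z. G z z) z)"
  proof (induction js)
    case Nil
    then show ?case using G by auto
  next
    case (Cons j js)
    then obtain G1 where G1: "polarized U G1"
      "\<And>z w. z \<in> U \<Longrightarrow> w \<in> U \<Longrightarrow> G1 z w = ?P js (\<lambda>z. G z w) z"
      "\<And>z. z \<in> U \<Longrightarrow> G1 z z = ?P js (\<lambda>z. G z z) z" by blast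
    from polarized_dbar_op[OF G1(1) U x \<beta>] obtain G2 where "polarized U G2
      \<and> (\<forall>z\<in>U. \<forall>w\<in>U. G2 z w = dbar_op (x j) (\<beta> j) (\<lambda>z. G1 z w) z)" by (rule exE)
    then have G2: "polarized U G2"
      "\<And>z w. z \<in> U \<Longrightarrow> w \<in> U \<Longrightarrow> G2 z w = dbar_op (x j) (\<beta> j) (\<lambda>z. G1 z w) z" by auto
    have "G2 z w = ?P (j # js) (\<lambda>z. G z w) z" if "z \<in> U" "w \<in> U" for z w
      using that by (simp add: G2) (rule dbar_op_cong[OF U], auto simp: G1)
    moreover have "G2 z z = ?P (j # js) (\<lambda>z. G z z) z" if "z \<in> U" for z
    proof -
      have "G2 z z = dbar_op (x j) (\<beta> j) (\<lambda>z. G1 z z) z"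
        using that polarized_diagonal(3)[OF G1(1) that that] by (simp add: G2 dbar_op_def)
      also have "\<dots> = dbar_op (x j) (\<beta> j) (?P js (\<lambda>z. G z z)) z"
        by (rule dbar_op_cong[OF U that G1(3)])
      finally show ?thesis by simp
    qed
    ultimately show ?case
      by (intro exI[of _ G2] conjI ballI G2(1))
  qed
  then obtain G' where "\<forall>z\<in>U. \<forall>w\<in>U. G' z w = ?P js (\<lambda>z. G z w) z"
    "\<forall>z\<in>U. G' z z = ?P js (\<lambda>z. G z z) z" by blast
  then have "G' z z = ?P js (\<lambda>y. G y z) z" "G' z z = ?P js (\<lambda>z. G z z) z"
    using z by auto
  then show ?thesis by simp
qed

section \<open>Operators in the charts of a Kaehler orbit\<close>

locale kaehler_orbit =
  fixes br :: "'g::euclidean_space \<Rightarrow> 'g \<Rightarrow> 'g"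
    and X :: "'g dual set"
    and A :: "('g dual, 'n::finite, 'i) atlas"
    and F :: "'i \<times> (complex^'n) \<Rightarrow> real"
    and hbar :: real
    and \<eta> :: "'m \<Rightarrow> 'g"
  assumes lie: "lie_bracket br"
    and cs: "complex_structure br X A"
    and kae: "kaehler br A"
    and pot: "kaehler_potentials br A F"
    and hbar: "0 < hbar"
begin

abbreviation chart_domain where "chart_domain i \<equiv> domain_of A i"
abbreviation coordinate where "coordinate i j \<equiv> coord_fun \<eta> j \<circ> param A i"

lemma chart_smooth: "i \<in> idx A \<Longrightarrow> smooth_on (chart_domain i) (param A i)"
  and chart_inj: "i \<in> idx A \<Longrightarrow> inj_on (param A i) (chart_domain i)"
  and chart_bij: "i \<in> idx A \<Longrightarrow> z \<in> chart_domain i \<Longrightarrow>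
    bij_betw (frechet_derivative (param A i) (at z)) UNIV (orbit_tangent br (param A i z))"
  and transition: "i \<in> idx A \<Longrightarrow> k \<in> idx A \<Longrightarrow>
    holomorphic_map (change_domain A id i k) (chart_expr A id i k)"
  and points: "point A ` coord_points A = X"
  using cs by (auto simp: complex_structure_def)

lemma chart_open: "i \<in> idx A \<Longrightarrow> open (chart_domain i)"
  using chart_smooth smooth_on_open by blast

lemma chart_linear:
  assumes "i \<in> idx A" "z \<in> chart_domain i"
  shows "linear (frechet_derivative (param A i) (at z))"
  using smooth_on_has_derivative[OF chart_smooth[OF assms(1)] assms(2)] by (rule has_derivative_linear)

lemma chart_form:
  assumes "i \<in> idx A" "z \<in> chart_domain i"
  shows "linear (\<lambda>v. pull_form br (param A i) z v w)" "linear (pull_form br (param A i) z v)"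
    and "pull_form br (param A i) z (\<i> *s v) (\<i> *s w) = pull_form br (param A i) z v w"
    and "v \<noteq> 0 \<Longrightarrow> 0 < pull_form br (param A i) z (\<i> *s v) v"
proof -
  have "range (frechet_derivative (param A i) (at z)) = orbit_tangent br (param A i z)"
    using chart_bij[OF assms] by (simp add: bij_betw_def)
  from linear_pull_form[OF lie chart_linear[OF assms] this]
  show "linear (\<lambda>v. pull_form br (param A i) z v w)" "linear (pull_form br (param A i) z v)" .
  show "pull_form br (param A i) z (\<i> *s v) (\<i> *s w) = pull_form br (param A i) z v w"
    and "v \<noteq> 0 \<Longrightarrow> 0 < pull_form br (param A i) z (\<i> *s v) v"
    using kae assms by (auto simp: kaehler_def)
qed

lemma chart_omega_invertible:
  assumes "i \<in> idx A" "z \<in> chart_domain i"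
  shows "invertible (omega br (param A i) z)"
  using chart_form[OF assms] by (intro omega_invertible) auto

lemma chart_omega_smooth:
  assumes i: "i \<in> idx A"
  shows "smooth_on (chart_domain i) (\<lambda>z. omega br (param A i) z $ \<nu> $ \<mu>)"
proof -
  have "smooth_on (chart_domain i) (\<lambda>z. F (i, z))"
    using pot i by (simp add: kaehler_potentials_def)
  then have "smooth_on (chart_domain i) (\<lambda>z. complex_of_real (F (i, z)))"
    by (rule smooth_on_bounded_linear[OF bounded_linear_of_real])
  then have "smooth_on (chart_domain i) (dzbar \<nu> (dz \<mu> (\<lambda>z. complex_of_real (F (i, z)))))"
    by (intro smooth_on_dzbar smooth_on_dz)
  moreover have "smooth_on (chart_domain i) (\<lambda>z. omega br (param A i) z $ \<nu> $ \<mu>)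
      \<longleftrightarrow> smooth_on (chart_domain i) (dzbar \<nu> (dz \<mu> (\<lambda>z. complex_of_real (F (i, z)))))"
    by (rule smooth_on_cong) (use pot i in \<open>simp add: kaehler_potentials_def\<close>)
  ultimately show ?thesis by simp
qed

lemma coordinate_smooth:
  assumes i: "i \<in> idx A"
  shows "smooth_on (chart_domain i) (coordinate i j)"
proof -
  have "bounded_linear (\<lambda>\<xi>. complex_of_real (blinfun_apply \<xi> (\<eta> j)))"
    by (rule bounded_linear_compose[OF bounded_linear_of_real blinfun.bounded_linear_left])
  from smooth_on_bounded_linear[OF this chart_smooth[OF i]]
  show ?thesis by (simp add: coord_fun_def o_def)
qed

text \<open>The factor is \<open>hbar\<close> because \<open>(-i hbar) \<cdot> i = hbar\<close>, the second \<open>i\<close> being that in \<open>ad\<^sub>-\<close>.\<close>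

definition coefficient where
  "coefficient i j \<nu> z = of_real hbar *
     (\<Sum>\<mu>\<in>UNIV. matrix_inv (omega br (param A i) z) $ \<mu> $ \<nu> * dz \<mu> (coordinate i j) z)"

definition chart_op where
  "chart_op i j = dbar_op (coordinate i j) (coefficient i j)"

lemma chart_op_eq:
  "chart_op i j \<rho> z = coordinate i j z * \<rho> z
     - \<i> * of_real hbar * ad_minus_chart br (param A i) (coordinate i j) \<rho> z"
proof -
  have "(\<Sum>\<nu>\<in>UNIV. coefficient i j \<nu> z * dzbar \<nu> \<rho> z) = of_real hbar *
      (\<Sum>\<mu>\<in>UNIV. \<Sum>\<nu>\<in>UNIV. matrix_inv (omega br (param A i) z) $ \<mu> $ \<nu> * dz \<mu> (coordinate i j) z * dzbar \<nu> \<rho> z)"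
    by (subst sum.swap) (simp add: coefficient_def sum_distrib_left sum_distrib_right mult_ac)
  moreover have "\<i> * c * (\<i> * s) = - (c * s)" for c s :: complex
    by (simp add: algebra_simps)
  ultimately show ?thesis
    by (simp add: chart_op_def dbar_op_def ad_minus_chart_def)
qed

lemma coefficient_smooth:
  assumes i: "i \<in> idx A"
  shows "smooth_on (chart_domain i) (coefficient i j \<nu>)"
proof -
  have "smooth_on (chart_domain i) (\<lambda>z. of_real hbar *
     (\<Sum>\<mu>\<in>UNIV. matrix_inv (omega br (param A i) z) $ \<mu> $ \<nu> * dz \<mu> (coordinate i j) z))"
    by (rule smooth_on_mult[OF smooth_on_const[OF chart_open[OF i]]],
        rule smooth_on_sum[OF chart_open[OF i]], rule smooth_on_mult,
        rule smooth_on_matrix_inv[OF chart_open[OF i] chart_omega_smooth[OF i] chart_omega_invertible[OF i]],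
        assumption, rule smooth_on_dz[OF coordinate_smooth[OF i]])
  moreover have "coefficient i j \<nu> = (\<lambda>z. of_real hbar *
     (\<Sum>\<mu>\<in>UNIV. matrix_inv (omega br (param A i) z) $ \<mu> $ \<nu> * dz \<mu> (coordinate i j) z))"
    by (rule ext) (rule coefficient_def)
  ultimately show ?thesis by simp
qed

lemma chart_op_smooth:
  "i \<in> idx A \<Longrightarrow> smooth_on (chart_domain i) \<rho> \<Longrightarrow> smooth_on (chart_domain i) (chart_op i j \<rho>)"
  unfolding chart_op_def by (intro smooth_on_dbar_op coordinate_smooth coefficient_smooth)

lemma foldr_chart_op_smooth:
  "i \<in> idx A \<Longrightarrow> smooth_on (chart_domain i) \<rho> \<Longrightarrow> smooth_on (chart_domain i) (foldr (chart_op i) js \<rho>)"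
  by (induction js) (simp_all add: chart_op_smooth)

lemma chart_op_cong:
  "i \<in> idx A \<Longrightarrow> z \<in> chart_domain i \<Longrightarrow> (\<And>y. y \<in> chart_domain i \<Longrightarrow> f y = g y) \<Longrightarrow> chart_op i j f z = chart_op i j g z"
  unfolding chart_op_def by (rule dbar_op_cong[OF chart_open])

subsection \<open>Change of charts\<close>

lemma change_domainD:
  assumes "i \<in> idx A" "k \<in> idx A" "z \<in> change_domain A id i k"
  shows "z \<in> chart_domain i" "chart_expr A id i k z \<in> chart_domain k"
    and "param A k (chart_expr A id i k z) = param A i z"
  using assms by (auto simp: change_domain_def chart_expr_def inv_into_into f_inv_into_f)

lemma chart_expr_eqI:
  assumes "i \<in> idx A" "k \<in> idx A" "z \<in> chart_domain i" "w \<in> chart_domain k" "param A i z = param A k w"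
  shows "z \<in> change_domain A id i k" "chart_expr A id i k z = w"
  using assms chart_inj[OF assms(2)] by (auto simp: change_domain_def chart_expr_def)

text \<open>A change of charts has a complex linear derivative \<open>T\<close>, which preserves the Hermitian forms and
  carries \<open>\<partial>x\<^sup>j\<close> in one chart to that in the other; so it carries the vectors representing
  \<open>ad\<^sub>-(x\<^sup>j)\<close> to each other. A factor \<open>\<gamma>\<close> with vanishing antiholomorphic derivative comes out. It is
  \<open>1\<close> for functions on the orbit; for the kernel it comes from the transition functions of the bundle.\<close>

lemma chart_op_change:
  assumes i: "i \<in> idx A" and k: "k \<in> idx A" and z: "z \<in> change_domain A id i k"
    and \<sigma>: "\<And>y. y \<in> change_domain A id i k \<Longrightarrow> \<sigma> y = \<gamma> y * S (chart_expr A id i k y)"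
    and \<gamma>: "\<gamma> differentiable (at z)" "\<And>v. delbar \<gamma> z v = 0"
    and S: "S differentiable (at (chart_expr A id i k z))"
  shows "chart_op i j \<sigma> z = \<gamma> z * chart_op k j S (chart_expr A id i k z)"
proof -
  let ?\<tau> = "chart_expr A id i k" and ?W = "change_domain A id i k"
  let ?w = "?\<tau> z"
  have W: "open ?W" using transition[OF i k] by (simp add: holomorphic_map_def)
  note zw = change_domainD[OF i k z]
  obtain T where T: "(?\<tau> has_derivative T) (at z)" and Tc: "\<And>c v. T (c *s v) = c *s T v"
    using transition[OF i k] z by (auto simp: holomorphic_map_def)
  let ?D = "frechet_derivative (param A i) (at z)" and ?D' = "frechet_derivative (param A k) (at ?w)"
  have D': "(param A k has_derivative ?D') (at ?w)"
    by (rule smooth_on_has_derivative[OF chart_smooth[OF k] zw(2)])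
  have "((\<lambda>y. param A k (?\<tau> y)) has_derivative (\<lambda>v. ?D' (T v))) (at z)"
    by (rule has_derivative_compose[OF T D'])
  then have "(param A i has_derivative (\<lambda>v. ?D' (T v))) (at z)"
    by (rule has_derivative_transform_within_open[OF _ W z]) (simp add: change_domainD[OF i k])
  then have D: "?D = (\<lambda>v. ?D' (T v))" by (rule frechet_derivative_eqI)
  have form: "pull_form br (param A i) z u v = pull_form br (param A k) ?w (T u) (T v)" for u v
    by (simp add: pull_form_def D zw(3))
  have herm: "hermitian_form br (param A i) z u v = hermitian_form br (param A k) ?w (T u) (T v)" for u v
    by (simp add: hermitian_form_def form Tc)
  have surj: "\<exists>v. T v = u" for u
  proof -
    have "?D' u \<in> orbit_tangent br (param A i z)"
      using chart_bij[OF k zw(2)] by (auto simp: bij_betw_def zw(3))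
    then obtain v where "?D v = ?D' u"
      using chart_bij[OF i zw(1)] by (force simp: bij_betw_def)
    then have "?D' (T v) = ?D' u" by (simp add: D)
    then show ?thesis
      using chart_bij[OF k zw(2)] by (auto simp: bij_betw_def inj_def)
  qed
  have xi: "coordinate i j differentiable (at z)"
    using smooth_on_differentiable[OF coordinate_smooth[OF i] zw(1)] .
  have xk: "coordinate k j differentiable (at ?w)"
    using smooth_on_differentiable[OF coordinate_smooth[OF k] zw(2)] .
  have "((\<lambda>y. coordinate k j (?\<tau> y)) has_derivative
      (\<lambda>v. frechet_derivative (coordinate k j) (at ?w) (T v))) (at z)"
    by (rule has_derivative_compose[OF T xk[unfolded frechet_derivative_works]])
  then have "(coordinate i j has_derivative
      (\<lambda>v. frechet_derivative (coordinate k j) (at ?w) (T v))) (at z)"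
    by (rule has_derivative_transform_within_open[OF _ W z]) (simp add: change_domainD[OF i k])
  from frechet_derivative_eqI[OF this]
  have del: "del (coordinate i j) z v = del (coordinate k j) ?w (T v)" for v
    by (simp add: del_def Tc)
  obtain c where c: "\<And>v. hermitian_form br (param A i) z c v = del (coordinate i j) z v"
    using hermitian_dual_vector_exists[OF chart_form(1-3)[OF i zw(1)]
        chart_omega_invertible[OF i zw(1)] xi] by blast
  have c': "hermitian_form br (param A k) ?w (T c) u = del (coordinate k j) ?w u" for u
    using surj[of u] c herm del by metis
  have "((\<lambda>y. S (?\<tau> y)) has_derivative (\<lambda>v. frechet_derivative S (at ?w) (T v))) (at z)"
    by (rule has_derivative_compose[OF T S[unfolded frechet_derivative_works]])
  from has_derivative_mult[OF \<gamma>(1)[unfolded frechet_derivative_works] this]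
  have "(\<sigma> has_derivative (\<lambda>v. \<gamma> z * frechet_derivative S (at ?w) (T v)
      + frechet_derivative \<gamma> (at z) v * S ?w)) (at z)"
    by (rule has_derivative_transform_within_open[OF _ W z]) (simp add: \<sigma>)
  note \<sigma>' = this frechet_derivative_eqI[OF this]
  have "delbar \<sigma> z c = \<gamma> z * delbar S ?w (T c) + delbar \<gamma> z c * S ?w"
    by (simp add: delbar_def \<sigma>'(2) Tc field_simps)
  then have delbar: "delbar \<sigma> z c = \<gamma> z * delbar S ?w (T c)"
    by (simp add: \<gamma>(2))
  have "\<sigma> differentiable (at z)" using \<sigma>'(1) by (auto simp: differentiable_def)
  then have "ad_minus_chart br (param A i) (coordinate i j) \<sigma> z = \<i> * delbar \<sigma> z c"
    by (intro ad_minus_chart_eq_delbar[OF chart_form(1-3)[OF i zw(1)]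
        chart_omega_invertible[OF i zw(1)] xi _ c])
  moreover have "ad_minus_chart br (param A k) (coordinate k j) S ?w = \<i> * delbar S ?w (T c)"
    by (intro ad_minus_chart_eq_delbar[OF chart_form(1-3)[OF k zw(2)]
        chart_omega_invertible[OF k zw(2)] xk S c'])
  moreover have "coordinate i j z = coordinate k j ?w" by (simp add: zw(3))
  ultimately show ?thesis
    by (simp add: chart_op_eq delbar \<sigma>[OF z] algebra_simps)
qed

lemma foldr_chart_op_change:
  assumes i: "i \<in> idx A" and k: "k \<in> idx A"
    and \<sigma>: "\<And>y. y \<in> change_domain A id i k \<Longrightarrow> \<sigma> y = \<gamma> y * S (chart_expr A id i k y)"
    and \<gamma>: "\<And>z. z \<in> change_domain A id i k \<Longrightarrow> \<gamma> differentiable (at z)"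
      "\<And>z v. z \<in> change_domain A id i k \<Longrightarrow> delbar \<gamma> z v = 0"
    and S: "smooth_on (chart_domain k) S"
    and z: "z \<in> change_domain A id i k"
  shows "foldr (chart_op i) js \<sigma> z = \<gamma> z * foldr (chart_op k) js S (chart_expr A id i k z)"
  using z
proof (induction js arbitrary: z)
  case Nil
  then show ?case using \<sigma>[OF Nil] by (simp add: id_def)
next
  case (Cons j js)
  have "foldr (chart_op k) js S differentiable (at (chart_expr A id i k z))"
    by (rule smooth_on_differentiable[OF foldr_chart_op_smooth[OF k S] change_domainD(2)[OF i k Cons.prems]])
  from chart_op_change[OF i k Cons.prems Cons.IH \<gamma>[OF Cons.prems] this]
  show ?case by (simp only: foldr.simps o_apply)
qed

lemma coords_at_point:
  assumes "p \<in> coord_points A"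
  shows "coords_at A (point A p) \<in> coord_points A" "point A (coords_at A (point A p)) = point A p"
proof -
  have "coords_at A (point A p) \<in> coord_points A \<and> point A (coords_at A (point A p)) = point A p"
    unfolding coords_at_def by (rule someI_ex) (use assms in blast)
  then show "coords_at A (point A p) \<in> coord_points A" "point A (coords_at A (point A p)) = point A p"
    by auto
qed

definition orbit_op where
  "orbit_op j \<rho> \<zeta> = coord_fun \<eta> j \<zeta> * \<rho> \<zeta> - \<i> * of_real hbar * ad_minus br A (coord_fun \<eta> j) \<rho> \<zeta>"

text \<open>An operator on the orbit is evaluated in whichever chart is chosen at the point; since the
  function it acts on has compatible expressions in all charts, that chart may be exchanged for the given one.\<close>

lemma foldr_orbit_op:
  assumes "i \<in> idx A" "z \<in> chart_domain i"
  shows "foldr orbit_op js (\<lambda>_. 1) (param A i z) = foldr (chart_op i) js (\<lambda>_. 1) z"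
  using assms
proof (induction js arbitrary: i z)
  case Nil
  then show ?case by simp
next
  case (Cons j js)
  let ?R = "foldr orbit_op js (\<lambda>_. 1)"
  have "(i, z) \<in> coord_points A" using Cons.prems by (simp add: coord_points_def)
  note * = coords_at_point[OF this]
  obtain k w where kw: "coords_at A (param A i z) = (k, w)" by fastforce
  have k: "k \<in> idx A" "w \<in> chart_domain k" and pt: "param A k w = param A i z"
    using * by (auto simp: kw coord_points_def point_def)
  have "orbit_op j ?R (param A i z) = chart_op k j (?R \<circ> param A k) w"
    by (simp add: orbit_op_def ad_minus_def kw chart_op_eq pt)
  also have "\<dots> = foldr (chart_op k) (j # js) (\<lambda>_. 1) w"
    using k by (auto intro!: chart_op_cong simp: Cons.IH)
  also have "\<dots> = foldr (chart_op i) (j # js) (\<lambda>_. 1) z"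
    using foldr_chart_op_change[OF Cons.prems(1) k(1) _ _ _ smooth_on_const[OF chart_open[OF k(1)], of 1],
        of "\<lambda>_. 1" "\<lambda>_. 1" z "j # js"]
      chart_expr_eqI[OF Cons.prems(1) k(1) Cons.prems(2) k(2) pt[symmetric]]
    by (simp add: delbar_def)
  finally show ?case by simp
qed

subsection \<open>Conjugation by the potential\<close>

text \<open>Differentiating \<open>exp(F\<^sub>0/hbar)\<close> produces \<open>-i ad\<^sub>-(x\<^sup>j)(F\<^sub>0)\<close>, which cancels the corresponding term of
  \<open>xhat\<^sup>j\<close>.\<close>

lemma xhat_conjugation:
  assumes i: "i \<in> idx A" and z: "z \<in> chart_domain i" and \<rho>: "smooth_on (chart_domain i) \<rho>"
    and u: "\<And>y. y \<in> chart_domain i \<Longrightarrow> u (i, y) = exp (of_real (F (i, y) / hbar)) * \<rho> y"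
  shows "xhat br A F hbar \<eta> j u (i, z) = exp (of_real (F (i, z) / hbar)) * chart_op i j \<rho> z"
proof -
  let ?F = "\<lambda>y. complex_of_real (F (i, y))" and ?h = "complex_of_real hbar"
  let ?ad = "ad_minus_chart br (param A i) (coordinate i j)"
  let ?e = "exp (of_real (F (i, z) / hbar)) :: complex"
  have F: "smooth_on (chart_domain i) ?F"
    by (rule smooth_on_bounded_linear[OF bounded_linear_of_real])
      (use pot i in \<open>simp add: kaehler_potentials_def\<close>)
  have dF: "?F differentiable (at z)" by (rule smooth_on_differentiable[OF F z])
  have dF': "(\<lambda>y. ?F y * (1 / ?h)) differentiable (at z)"
    using smooth_on_differentiable[OF smooth_on_mult[OF F smooth_on_const[OF chart_open[OF i]]] z] .
  have d\<rho>: "\<rho> differentiable (at z)" by (rule smooth_on_differentiable[OF \<rho> z])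
  have dE: "(\<lambda>y. exp (?F y * (1 / ?h))) differentiable (at z)"
    using smooth_on_differentiable[OF smooth_on_exp[OF smooth_on_mult[OF F smooth_on_const[OF chart_open[OF i]]]] z] .
  have "dzbar \<nu> (\<lambda>y. u (i, y)) z = ?e * (dzbar \<nu> ?F z / ?h * \<rho> z + dzbar \<nu> \<rho> z)" for \<nu>
  proof -
    have "dzbar \<nu> (\<lambda>y. u (i, y)) z = dzbar \<nu> (\<lambda>y. exp (?F y * (1 / ?h)) * \<rho> y) z"
      by (rule dzbar_cong[OF chart_open[OF i] z]) (simp add: u)
    also have "\<dots> = ?e * (dzbar \<nu> (\<lambda>y. ?F y * (1 / ?h)) z * \<rho> z + dzbar \<nu> \<rho> z)"
      by (subst dzbar_mult[OF dE d\<rho>], subst dzbar_exp[OF dF']) (simp add: algebra_simps)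
    also have "dzbar \<nu> (\<lambda>y. ?F y * (1 / ?h)) z = dzbar \<nu> ?F z / ?h"
      by (subst dzbar_mult[OF dF]) (simp_all add: dzbar_def)
    finally show ?thesis .
  qed
  then have "?ad (\<lambda>y. u (i, y)) z = ?e * (?ad ?F z / ?h * \<rho> z + ?ad \<rho> z)"
    by (simp add: ad_minus_chart_def algebra_simps sum.distrib sum_distrib_left sum_divide_distrib)
  moreover have "u (i, z) = ?e * \<rho> z" by (rule u[OF z])
  ultimately show ?thesis
    using hbar by (simp add: xhat_def Let_def chart_op_eq field_simps)
qed

lemma foldr_xhat_conjugation:
  assumes i: "i \<in> idx A" and \<rho>: "smooth_on (chart_domain i) \<rho>"
    and u: "\<And>y. y \<in> chart_domain i \<Longrightarrow> u (i, y) = exp (of_real (F (i, y) / hbar)) * \<rho> y" and z: "z \<in> chart_domain i"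
  shows "foldr (xhat br A F hbar \<eta>) js u (i, z)
    = exp (of_real (F (i, z) / hbar)) * foldr (chart_op i) js \<rho> z"
  using z
proof (induction js arbitrary: z)
  case Nil
  then show ?case by (simp add: u)
next
  case (Cons j js)
  show ?case
    using xhat_conjugation[OF i Cons.prems foldr_chart_op_smooth[OF i \<rho>] Cons.IH] by simp
qed

end

section \<open>The reproducing kernel and its Wick symbols\<close>

lemma antiholomorphic_funD:
  assumes "antiholomorphic_fun S f" "z \<in> S"
  shows "(f has_derivative frechet_derivative f (at z)) (at z)"
    and "frechet_derivative f (at z) (c *s v) = cnj c * frechet_derivative f (at z) v"
proof -
  obtain D where D: "(f has_derivative D) (at z)" and anti: "\<And>c v. D (c *s v) = cnj c * D v"
    using assms by (auto simp: antiholomorphic_fun_def)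
  show "(f has_derivative frechet_derivative f (at z)) (at z)"
    and "frechet_derivative f (at z) (c *s v) = cnj c * frechet_derivative f (at z) v"
    using D anti by (simp_all add: frechet_derivative_eqI[OF D])
qed

lemma weyl_symmetrized_cong:
  assumes "\<And>js. foldr T js u x = c * foldr T' js u' y"
  shows "weyl_symmetrized f T u x = c * weyl_symmetrized f T' u' y"
proof -
  have "(\<Sum>js\<in>permutations_of_multiset m. foldr T js u x)
      = c * (\<Sum>js\<in>permutations_of_multiset m. foldr T' js u' y)" for m
    by (simp add: assms sum_distrib_left)
  then show ?thesis
    unfolding weyl_symmetrized_def
    by (simp only: mult.left_commute[of _ c] sum_distrib_left[symmetric])
qed

locale quantized_orbit = kaehler_orbit br X A F hbar \<eta>
  for br :: "'g::euclidean_space \<Rightarrow> 'g \<Rightarrow> 'g"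
    and X :: "'g dual set"
    and A :: "('g dual, 'n::finite, 'i) atlas"
    and F :: "'i \<times> (complex^'n) \<Rightarrow> real"
    and hbar :: real
    and \<eta> :: "'m \<Rightarrow> 'g" +
  fixes g :: "'i \<Rightarrow> 'i \<Rightarrow> complex^'n \<Rightarrow> complex"
    and B :: "('i, 'n) bsection set"
  assumes line_bundle: "hermitian_line_bundle A F hbar g"
    and sections: "\<And>u. u \<in> B \<Longrightarrow> antihol_section A g u"
    and normalized: "kernel_normalized A F hbar B"
begin

abbreviation K where "K \<equiv> sesqui_kernel B"

lemma coord_pointsI: "i \<in> idx A \<Longrightarrow> z \<in> chart_domain i \<Longrightarrow> (i, z) \<in> coord_points A"
  by (simp add: coord_points_def)

lemma kernel_diagonal:
  assumes "p \<in> coord_points A"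
  shows "K p p = exp (of_real (F p / hbar))"
proof -
  have "((\<lambda>u. (cmod (u p))\<^sup>2) has_sum exp (F p / hbar)) B"
    using normalized assms by (simp add: kernel_normalized_def)
  then have "((\<lambda>u. complex_of_real ((cmod (u p))\<^sup>2)) has_sum of_real (exp (F p / hbar))) B"
    by (rule has_sum_of_real)
  then have "((\<lambda>u. u p * cnj (u p)) has_sum of_real (exp (F p / hbar))) B"
    by (simp only: complex_norm_square)
  then show ?thesis
    unfolding sesqui_kernel_def exp_of_real by (rule infsumI)
qed

lemma kernel_J_holomorphic:
  assumes i: "i \<in> idx A" and k: "k \<in> idx A"
  shows "J_holomorphic polar_J (chart_domain i \<times> chart_domain k) (\<lambda>p. K (i, fst p) (k, snd p))"
  unfolding sesqui_kernel_def
proof (rule J_holomorphic_kernel)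
  let ?S = "chart_domain i \<times> chart_domain k"
  have F: "continuous_on (chart_domain l) (\<lambda>z. F (l, z))" if "l \<in> idx A" for l
    using pot that by (force simp: kaehler_potentials_def smooth_on_def dest: spec[of _ 0])
  have anti: "antiholomorphic_fun (chart_domain l) (\<lambda>z. u (l, z))" if "l \<in> idx A" "u \<in> B" for l u
    using sections[OF that(2)] that(1) by (simp add: antihol_section_def)
  have cont: "continuous_on (chart_domain l) (\<lambda>z. u (l, z))" if "l \<in> idx A" "u \<in> B" for l u
    using antiholomorphic_funD(1)[OF anti[OF that]] has_derivative_continuous
    by (intro continuous_at_imp_continuous_on) blast
  show "open ?S" by (intro open_Times chart_open i k)
  show "((\<lambda>u. (cmod (u (i, fst p)))\<^sup>2) has_sum exp (F (i, fst p) / hbar)) B" if "p \<in> ?S" for p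
    using normalized that i by (auto simp: kernel_normalized_def intro: coord_pointsI)
  show "((\<lambda>u. (cmod (cnj (u (k, snd p))))\<^sup>2) has_sum exp (F (k, snd p) / hbar)) B" if "p \<in> ?S" for p
    using normalized that k by (auto simp: kernel_normalized_def intro: coord_pointsI)
  show "continuous_on ?S (\<lambda>p. exp (F (i, fst p) / hbar))"
    using hbar by (intro continuous_intros continuous_on_compose2[OF F[OF i]]) auto
  show "continuous_on ?S (\<lambda>p. exp (F (k, snd p) / hbar))"
    using hbar by (intro continuous_intros continuous_on_compose2[OF F[OF k]]) auto
  show "norm (polar_J v) \<le> norm v" for v :: "(complex^'n) \<times> (complex^'n)"
    by (rule norm_polar_J)
  fix u assume u: "u \<in> B"
  show "continuous_on ?S (\<lambda>p. u (i, fst p))"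
    by (intro continuous_intros continuous_on_compose2[OF cont[OF i u]]) auto
  show "continuous_on ?S (\<lambda>p. cnj (u (k, snd p)))"
    by (intro continuous_intros continuous_on_compose2[OF cont[OF k u]]) auto
  have hol1: "J_holomorphic polar_J ?S (\<lambda>p. u (i, fst p))"
    unfolding J_holomorphic_def
  proof (intro conjI ballI)
    show "open ?S" by (intro open_Times chart_open i k)
    fix p assume "p \<in> ?S"
    then have "fst p \<in> chart_domain i" by auto
    note D = antiholomorphic_funD[OF anti[OF i u] this]
    have "(fst has_derivative fst) (at p)" by (auto intro!: derivative_eq_intros)
    note D' = has_derivative_compose[OF this D(1)]
    show "\<exists>D. ((\<lambda>p. u (i, fst p)) has_derivative D) (at p) \<and> (\<forall>v. D (polar_J v) = \<i> * D v)"
      by (rule exI, rule conjI, rule D') (simp only: polar_J_def fst_conv D(2), simp)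
  qed
  have hol2: "J_holomorphic polar_J ?S (\<lambda>p. cnj (u (k, snd p)))"
    unfolding J_holomorphic_def
  proof (intro conjI ballI)
    show "open ?S" by (intro open_Times chart_open i k)
    fix p assume "p \<in> ?S"
    then have "snd p \<in> chart_domain k" by auto
    note D = antiholomorphic_funD[OF anti[OF k u] this]
    have "(snd has_derivative snd) (at p)" by (auto intro!: derivative_eq_intros)
    note D' = has_derivative_cnj[OF has_derivative_compose[OF this D(1)]]
    show "\<exists>D. ((\<lambda>p. cnj (u (k, snd p))) has_derivative D) (at p) \<and> (\<forall>v. D (polar_J v) = \<i> * D v)"
      by (rule exI, rule conjI, rule D') (simp only: polar_J_def snd_conv D(2), simp)
  qed
  show "J_holomorphic polar_J ?S (\<lambda>p. u (i, fst p) * cnj (u (k, snd p)))"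
    by (rule J_holomorphic_mult[OF hol1 hol2])
qed

text \<open>The factor \<open>\<rho>\<^sub>q\<close> of the kernel, on which \<open>xhat\<^sup>j\<close> becomes \<open>x\<^sup>j - i hbar ad\<^sub>-(x\<^sup>j)\<close>.\<close>

definition reduced_kernel where
  "reduced_kernel q i z = exp (- of_real (F (i, z) / hbar)) * K (i, z) q"

lemma exp_potential_smooth:
  assumes i: "i \<in> idx A"
  shows "smooth_on (chart_domain i) (\<lambda>z. exp (- complex_of_real (F (i, z) / hbar)))"
proof -
  have "bounded_linear (\<lambda>x. - complex_of_real (x / hbar))"
    by (intro bounded_linear_minus bounded_linear_compose[OF bounded_linear_of_real bounded_linear_divide])
  from smooth_on_bounded_linear[OF this, of "chart_domain i" "\<lambda>z. F (i, z)"]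
  show ?thesis
    using pot i by (intro smooth_on_exp) (simp add: kaehler_potentials_def)
qed

lemma reduced_kernel_smooth:
  assumes i: "i \<in> idx A" and q: "q \<in> coord_points A"
  shows "smooth_on (chart_domain i) (reduced_kernel q i)"
proof -
  obtain k w where q': "q = (k, w)" and k: "k \<in> idx A" and w: "w \<in> chart_domain k"
    using q by (cases q) (auto simp: coord_points_def)
  have "J_holomorphic (\<lambda>v. (- \<i>) *s v) (chart_domain i) (\<lambda>z. K (i, z) (k, w))"
    unfolding J_holomorphic_def
  proof (intro conjI ballI)
    show "open (chart_domain i)" by (rule chart_open[OF i])
    fix z assume z: "z \<in> chart_domain i"
    note H = J_holomorphic_slice_derivatives[OF kernel_J_holomorphic[OF i k] z w]
    show "\<exists>D. ((\<lambda>z. K (i, z) (k, w)) has_derivative D) (at z) \<and> (\<forall>v. D ((- \<i>) *s v) = \<i> * D v)"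
      using H(1,4) by (intro exI conjI allI) simp_all
  qed
  from J_holomorphic_imp_smooth[OF this]
  have "smooth_on (chart_domain i) (\<lambda>z. K (i, z) q)"
    by (simp add: norm_smult_complex q')
  from smooth_on_mult[OF exp_potential_smooth[OF i] this]
  show ?thesis by (simp add: reduced_kernel_def[abs_def])
qed

lemma reduced_kernel_polarized:
  assumes i: "i \<in> idx A"
  shows "polarized (chart_domain i) (\<lambda>z w. reduced_kernel (i, w) i z)"
proof -
  have "polarized (chart_domain i) (\<lambda>z w. exp (- complex_of_real (F (i, z) / hbar)) * K (i, fst (z, w)) (i, snd (z, w)))"
    by (rule polarized.prod[OF exp_potential_smooth[OF i] kernel_J_holomorphic[OF i i]])
  then show ?thesis by (simp only: reduced_kernel_def fst_conv snd_conv)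
qed

lemma kernel_eq_reduced: "K (i, z) q = exp (of_real (F (i, z) / hbar)) * reduced_kernel q i z"
  by (simp add: reduced_kernel_def exp_minus)

text \<open>On the diagonal the reduced kernel is \<open>1\<close> by the normalization of the measure, and the operators
  do not distinguish it from its restriction to the diagonal.\<close>

lemma reduced_kernel_at_diagonal:
  assumes i: "i \<in> idx A" and z: "z \<in> chart_domain i"
  shows "foldr (chart_op i) js (reduced_kernel (i, z) i) z = foldr (chart_op i) js (\<lambda>_. 1) z"
proof -
  have "foldr (chart_op i) js (\<lambda>y. reduced_kernel (i, y) i y) z
      = foldr (chart_op i) js (\<lambda>y. reduced_kernel (i, z) i y) z"
    unfolding chart_op_def
    by (rule foldr_dbar_op_diagonal[OF reduced_kernel_polarized[OF i] chart_open[OF i]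
          coordinate_smooth[OF i] coefficient_smooth[OF i] z])
  moreover have "foldr (chart_op i) js (\<lambda>y. reduced_kernel (i, y) i y) y
      = foldr (chart_op i) js (\<lambda>_. 1) y" if "y \<in> chart_domain i" for y
    using that
  proof (induction js arbitrary: y)
    case Nil
    then show ?case
      using i by (simp add: reduced_kernel_def kernel_diagonal coord_pointsI exp_minus)
  next
    case (Cons j js)
    have "chart_op i j (foldr (chart_op i) js (\<lambda>y. reduced_kernel (i, y) i y)) y
        = chart_op i j (foldr (chart_op i) js (\<lambda>_. 1)) y"
      by (rule chart_op_cong[OF i Cons.prems Cons.IH])
    then show ?case by simp
  qed
  ultimately show ?thesis using z by simp
qed

abbreviation xhat_weyl where
  "xhat_weyl f \<equiv> weyl_symmetrized f (xhat br A F hbar \<eta>)"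

lemma xhat_weyl_kernel:
  assumes i: "i \<in> idx A" and z: "z \<in> chart_domain i" and q: "q \<in> coord_points A"
  shows "xhat_weyl f (\<lambda>p. K p q) (i, z)
    = exp (of_real (F (i, z) / hbar)) * weyl_symmetrized f (chart_op i) (reduced_kernel q i) z"
proof (rule weyl_symmetrized_cong)
  fix js
  show "foldr (xhat br A F hbar \<eta>) js (\<lambda>p. K p q) (i, z)
      = exp (of_real (F (i, z) / hbar)) * foldr (chart_op i) js (reduced_kernel q i) z"
    by (rule foldr_xhat_conjugation[where u = "\<lambda>p. K p q",
          OF i reduced_kernel_smooth[OF i q] kernel_eq_reduced z])
qed

lemma transition_nonzero:
  assumes "i \<in> idx A" "k \<in> idx A" "z \<in> chart_domain i" "w \<in> chart_domain k" "param A i z = param A k w"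
  shows "g i k z \<noteq> 0" "(cmod (g i k z))\<^sup>2 * exp (- F (i, z) / hbar) = exp (- F (k, w) / hbar)"
proof -
  have "\<forall>(i, z)\<in>coord_points A. \<forall>(k, w)\<in>coord_points A. param A i z = param A k w \<longrightarrow>
      (cmod (g i k z))\<^sup>2 * exp (- F (i, z) / hbar) = exp (- F (k, w) / hbar)"
    using line_bundle unfolding hermitian_line_bundle_def by (elim conjE)
  from bspec[OF this coord_pointsI[OF assms(1,3)]]
  have "\<forall>(k, w)\<in>coord_points A. param A i z = param A k w \<longrightarrow>
      (cmod (g i k z))\<^sup>2 * exp (- F (i, z) / hbar) = exp (- F (k, w) / hbar)" by simp
  from bspec[OF this coord_pointsI[OF assms(2,4)]]
  show eq: "(cmod (g i k z))\<^sup>2 * exp (- F (i, z) / hbar) = exp (- F (k, w) / hbar)"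
    using assms(5) by simp
  then show "g i k z \<noteq> 0" by auto
qed

lemma section_transition:
  assumes "u \<in> B" "i \<in> idx A" "k \<in> idx A" "z \<in> chart_domain i" "w \<in> chart_domain k" "param A i z = param A k w"
  shows "u (i, z) = g i k z * u (k, w)"
proof -
  have "\<forall>(i, z)\<in>coord_points A. \<forall>(k, w)\<in>coord_points A.
      param A i z = param A k w \<longrightarrow> u (i, z) = g i k z * u (k, w)"
    using sections[OF assms(1)] by (simp add: antihol_section_def)
  from bspec[OF this coord_pointsI[OF assms(2,4)]]
  have "\<forall>(k, w)\<in>coord_points A. param A i z = param A k w \<longrightarrow> u (i, z) = g i k z * u (k, w)"
    by simp
  from bspec[OF this coord_pointsI[OF assms(3,5)]] show ?thesis using assms(6) by simp
qed

lemma kernel_transition: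
  assumes p: "i \<in> idx A" "k \<in> idx A" "z \<in> chart_domain i" "w \<in> chart_domain k" "param A i z = param A k w"
  shows "K (i, z) q = g i k z * K (k, w) q" "K q (i, z) = cnj (g i k z) * K q (k, w)"
proof -
  have "K (i, z) q = (\<Sum>\<^sub>\<infinity>u\<in>B. g i k z * (u (k, w) * cnj (u q)))"
    unfolding sesqui_kernel_def
    by (rule infsum_cong) (simp add: section_transition[OF _ p] mult_ac)
  then show "K (i, z) q = g i k z * K (k, w) q"
    by (simp add: infsum_cmult_right' sesqui_kernel_def)
  have "K q (i, z) = (\<Sum>\<^sub>\<infinity>u\<in>B. cnj (g i k z) * (u q * cnj (u (k, w))))"
    unfolding sesqui_kernel_def
    by (rule infsum_cong) (simp add: section_transition[OF _ p] mult_ac)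
  then show "K q (i, z) = cnj (g i k z) * K q (k, w)"
    by (simp add: infsum_cmult_right' sesqui_kernel_def)
qed

text \<open>The transition functions are antiholomorphic, so their conjugates are holomorphic.\<close>

lemma inverse_cnj_transition:
  assumes i: "i \<in> idx A" and k: "k \<in> idx A" and z: "z \<in> change_domain A id i k"
  shows "(\<lambda>y. inverse (cnj (g i k y)) * c) differentiable (at z)"
    and "delbar (\<lambda>y. inverse (cnj (g i k y)) * c) z v = 0"
proof -
  note zd = change_domainD[OF i k z]
  have nz: "cnj (g i k z) \<noteq> 0"
    using transition_nonzero(1)[OF i k zd(1,2) zd(3)[symmetric]] by simp
  have "antiholomorphic_fun (change_domain A id i k) (g i k)"
    using line_bundle i k by (simp add: hermitian_line_bundle_def)
  note D = antiholomorphic_funD[OF this z]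
  let ?D = "frechet_derivative (g i k) (at z)" and ?\<gamma> = "inverse (cnj (g i k z))"
  have "((\<lambda>y. inverse (cnj (g i k y)) * c) has_derivative
      (\<lambda>v. - (?\<gamma> * cnj (?D v) * ?\<gamma>) * c)) (at z)"
    by (intro has_derivative_mult_left Deriv.has_derivative_inverse[where f = "\<lambda>y. cnj (g i k y)", OF nz] has_derivative_cnj D(1))
  note D' = this frechet_derivative_eqI[OF this]
  show "(\<lambda>y. inverse (cnj (g i k y)) * c) differentiable (at z)"
    using D'(1) by (auto simp: differentiable_def)
  show "delbar (\<lambda>y. inverse (cnj (g i k y)) * c) z v = 0"
    unfolding delbar_def D'(2) D(2) by (simp add: algebra_simps)
qed

text \<open>Since \<open>\<bar>g\<bar>\<^sup>2\<close> is the quotient of the exponentials of the potentials, the weight \<open>exp(-F\<^sub>0/hbar)\<close> turns the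
  factor \<open>g\<close> of the kernel into \<open>1/\<close> the conjugate of \<open>g\<close>.\<close>

lemma reduced_kernel_transition:
  assumes i: "i \<in> idx A" and k: "k \<in> idx A" and z: "z \<in> chart_domain i" and w: "w \<in> chart_domain k"
    and eq: "param A i z = param A k w"
    and l: "l \<in> idx A" "l' \<in> idx A" "y \<in> chart_domain l" "y' \<in> chart_domain l'" "param A l y = param A l' y'"
  shows "reduced_kernel (l, y) i z
    = inverse (cnj (g i k z)) * cnj (g l l' y) * reduced_kernel (l', y') k w"
proof -
  note nz = transition_nonzero[OF i k z w eq]
  have "exp (- complex_of_real (F (k, w) / hbar))
      = g i k z * cnj (g i k z) * exp (- complex_of_real (F (i, z) / hbar))"
  proof -
    have "complex_of_real (exp (- F (k, w) / hbar))
        = of_real ((cmod (g i k z))\<^sup>2) * of_real (exp (- F (i, z) / hbar))"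
      by (simp only: nz(2)[symmetric] of_real_mult)
    moreover have "exp (- complex_of_real r) = complex_of_real (exp (- r))" for r
      by (simp only: of_real_minus[symmetric] exp_of_real)
    ultimately show ?thesis
      by (simp only: complex_norm_square minus_divide_left)
  qed
  then show ?thesis
    using nz(1)
    by (simp add: reduced_kernel_def kernel_transition(1)[OF i k z w eq]
        kernel_transition(2)[OF l] field_simps)
qed

text \<open>Both the kernel and its image acquire the same nonzero factor when the coordinates of the two
  points are changed.\<close>

lemma symbol_well_defined:
  assumes p: "p \<in> coord_points A" "p' \<in> coord_points A" "point A p = point A p'"
    and q: "q \<in> coord_points A" "q' \<in> coord_points A" "point A q = point A q'"
  shows "xhat_weyl f (\<lambda>p. K p q) p / K p q = xhat_weyl f (\<lambda>p. K p q') p' / K p' q'"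
proof -
  obtain i z k w where pp: "p = (i, z)" "p' = (k, w)" by fastforce
  obtain l y l' y' where qq: "q = (l, y)" "q' = (l', y')" by fastforce
  have ik: "i \<in> idx A" "k \<in> idx A" "z \<in> chart_domain i" "w \<in> chart_domain k" "param A i z = param A k w"
    using p by (auto simp: pp coord_points_def point_def)
  have ll: "l \<in> idx A" "l' \<in> idx A" "y \<in> chart_domain l" "y' \<in> chart_domain l'" "param A l y = param A l' y'"
    using q by (auto simp: qq coord_points_def point_def)
  note change = chart_expr_eqI[OF ik]
  define \<delta> where "\<delta> x = inverse (cnj (g i k x)) * cnj (g l l' y)" for x
  have \<delta>0: "\<delta> z \<noteq> 0"
    using transition_nonzero(1)[OF ik] transition_nonzero(1)[OF ll] by (simp add: \<delta>_def)
  have "foldr (chart_op i) js (reduced_kernel q i) z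
      = \<delta> z * foldr (chart_op k) js (reduced_kernel q' k) (chart_expr A id i k z)" for js
  proof (rule foldr_chart_op_change[OF ik(1,2) _ _ _ reduced_kernel_smooth[OF ik(2) q(2)] change(1)])
    fix x assume x: "x \<in> change_domain A id i k"
    note xd = change_domainD[OF ik(1,2) x]
    show "reduced_kernel q i x = \<delta> x * reduced_kernel q' k (chart_expr A id i k x)"
      unfolding qq \<delta>_def
      by (rule reduced_kernel_transition[OF ik(1,2) xd(1,2) xd(3)[symmetric] ll])
    show "\<delta> differentiable (at x)" "delbar \<delta> x v = 0" for v
      using inverse_cnj_transition[OF ik(1,2) x] by (simp_all add: \<delta>_def[abs_def])
  qed
  then have "weyl_symmetrized f (chart_op i) (reduced_kernel q i) z
      = \<delta> z * weyl_symmetrized f (chart_op k) (reduced_kernel q' k) w"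
    by (intro weyl_symmetrized_cong) (simp only: change(2))
  moreover have "reduced_kernel q i z = \<delta> z * reduced_kernel q' k w"
    unfolding qq \<delta>_def by (rule reduced_kernel_transition[OF ik ll])
  ultimately show ?thesis
    using \<delta>0 ik q by (simp add: pp xhat_weyl_kernel kernel_eq_reduced)
qed

lemma symbol_at_diagonal:
  assumes p: "p \<in> coord_points A"
  shows "xhat_weyl f (\<lambda>p'. K p' p) p / K p p = weyl_symmetrized f orbit_op (\<lambda>_. 1) (point A p)"
proof -
  obtain i z where pz: "p = (i, z)" and i: "i \<in> idx A" and z: "z \<in> chart_domain i"
    using p by (cases p) (auto simp: coord_points_def)
  have "weyl_symmetrized f (chart_op i) (reduced_kernel p i) z
      = 1 * weyl_symmetrized f orbit_op (\<lambda>_. 1) (point A p)"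
    by (rule weyl_symmetrized_cong)
      (simp add: pz point_def reduced_kernel_at_diagonal[OF i z] foldr_orbit_op[OF i z])
  then show ?thesis
    using xhat_weyl_kernel[OF i z p, of f] by (simp add: pz[symmetric] kernel_diagonal[OF p])
qed

text \<open>From left to right the defining relation is read on the diagonal, where the kernel does not vanish.
  From right to left the quotient itself serves as \<open>\<psi>\<^sup>#\<close>.\<close>

lemma wick_symbol_iff:
  "is_wick_symbol X A B (xhat_weyl f) \<psi> \<longleftrightarrow>
    (\<forall>\<xi>\<in>X. \<psi> \<xi> = weyl_symmetrized f orbit_op (\<lambda>_. 1) \<xi>)"
proof
  assume "is_wick_symbol X A B (xhat_weyl f) \<psi>"
  then obtain \<Psi> where *: "(\<forall>p\<in>coord_points A. \<forall>q\<in>coord_points A. K p q \<noteq> 0 \<longrightarrow>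
      xhat_weyl f (\<lambda>p'. K p' q) p = \<Psi> (point A p) (point A q) * K p q) \<and> (\<forall>\<xi>\<in>X. \<psi> \<xi> = \<Psi> \<xi> \<xi>)"
    unfolding is_wick_symbol_def by (rule exE)
  have \<Psi>: "xhat_weyl f (\<lambda>p'. K p' p) p = \<Psi> (point A p) (point A p) * K p p"
    if "p \<in> coord_points A" "K p p \<noteq> 0" for p
    using * that by simp
  have \<psi>: "\<psi> \<xi> = \<Psi> \<xi> \<xi>" if "\<xi> \<in> X" for \<xi>
    using * that by simp
  show "\<forall>\<xi>\<in>X. \<psi> \<xi> = weyl_symmetrized f orbit_op (\<lambda>_. 1) \<xi>"
  proof
    fix \<xi> assume "\<xi> \<in> X"
    then obtain p where p: "p \<in> coord_points A" "point A p = \<xi>" using points by blast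
    have "K p p \<noteq> 0" by (simp add: kernel_diagonal[OF p(1)])
    with \<Psi>[OF p(1) this] symbol_at_diagonal[OF p(1), of f]
    show "\<psi> \<xi> = weyl_symmetrized f orbit_op (\<lambda>_. 1) \<xi>"
      by (simp add: \<psi>[OF \<open>\<xi> \<in> X\<close>] p(2))
  qed
next
  assume \<psi>: "\<forall>\<xi>\<in>X. \<psi> \<xi> = weyl_symmetrized f orbit_op (\<lambda>_. 1) \<xi>"
  define symbol where "symbol p q = xhat_weyl f (\<lambda>p'. K p' q) p / K p q" for p q
  define \<Psi> where "\<Psi> \<xi> \<zeta> = symbol (coords_at A \<xi>) (coords_at A \<zeta>)" for \<xi> \<zeta>
  have \<Psi>: "\<Psi> (point A p) (point A q) = symbol p q"
    if "p \<in> coord_points A" "q \<in> coord_points A" for p q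
    unfolding \<Psi>_def symbol_def
    by (rule symbol_well_defined) (use that coords_at_point in auto)
  show "is_wick_symbol X A B (xhat_weyl f) \<psi>"
    unfolding is_wick_symbol_def
  proof (intro exI[of _ \<Psi>] conjI ballI impI)
    fix p q assume "p \<in> coord_points A" "q \<in> coord_points A" "K p q \<noteq> 0"
    then show "xhat_weyl f (\<lambda>p'. K p' q) p = \<Psi> (point A p) (point A q) * K p q"
      by (simp add: \<Psi> symbol_def)
  next
    fix \<xi> assume \<xi>: "\<xi> \<in> X"
    then obtain p where p: "p \<in> coord_points A" "point A p = \<xi>" using points by blast
    show "\<psi> \<xi> = \<Psi> \<xi> \<xi>"
      using \<psi> \<xi> \<Psi>[OF p(1) p(1)] symbol_at_diagonal[OF p(1), of f] by (simp add: symbol_def p(2))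
  qed
qed

end

theorem theorem4p1:
  fixes br :: "'g::euclidean_space \<Rightarrow> 'g \<Rightarrow> 'g"
    and \<eta> :: "'m::finite \<Rightarrow> 'g"
    and \<xi>\<^sub>0 :: "'g dual"
    and X :: "'g dual set"
    and A :: "('g dual, 'n::finite, 'i) atlas"
    and F :: "'i \<times> (complex^'n) \<Rightarrow> real"
    and g :: "'i \<Rightarrow> 'i \<Rightarrow> complex^'n \<Rightarrow> complex"
    and M :: "'g dual measure"
    and B :: "('i, 'n) bsection set"
    and hbar const :: real
    and f :: "'m multiset \<Rightarrow>\<^sub>0 complex"
    and \<psi> :: "'g dual \<Rightarrow> complex"
  assumes "lie_bracket br" and "lie_basis \<eta>" and "hbar > 0"
    and "X = coadjoint_orbit br \<xi>\<^sub>0" and "maximal_orbit br \<xi>\<^sub>0"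
    and "complex_structure br X A" and "invariant_structure br A" and "kaehler br A"
    and "integral_class br X hbar"
    and "kaehler_potentials br A F" and "hermitian_line_bundle A F hbar g"
    and "const > 0" and "liouville_measure br X A const M"
    and "orthonormal_section_basis A F hbar g M B" and "kernel_normalized A F hbar B"
  shows "is_quantum_restriction br X A F hbar B \<eta> f \<psi> \<longleftrightarrow>
    (\<forall>\<xi>\<in>X. \<psi> \<xi> =
       weyl_symmetrized f
         (\<lambda>j \<rho> \<zeta>. coord_fun \<eta> j \<zeta> * \<rho> \<zeta> - \<i> * of_real hbar * ad_minus br A (coord_fun \<eta> j) \<rho> \<zeta>)
         (\<lambda>_. 1) \<xi>)"
proof -
  interpret quantized_orbit br X A F hbar \<eta> g B
  proof unfold_locales
    show "antihol_section A g u" if "u \<in> B" for u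
    proof -
      have "B \<subseteq> section_space A F hbar g M"
        using assms(14) unfolding orthonormal_section_basis_def by (elim conjE)
      with that show ?thesis by (auto simp: section_space_def)
    qed
  qed (rule assms)+
  have "orbit_op = (\<lambda>j \<rho> \<zeta>. coord_fun \<eta> j \<zeta> * \<rho> \<zeta>
      - \<i> * of_real hbar * ad_minus br A (coord_fun \<eta> j) \<rho> \<zeta>)"
    by (intro ext) (rule orbit_op_def)
  then show ?thesis
    unfolding is_quantum_restriction_def wick_symbol_iff by simp
qed

end
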